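(* Let $A$ be a finite set of integers with $0\in A$, and let $\mathcal{A}:=A+[0,1]\subset\mathbb{R}$. The following statements are equivalent: (i) There exists an affine iterated function system of the form $\tau_b(x)=\frac{1}{n}(x+b)$, with $b\in B\subset\mathbb{Z}$ ($B$ finite) and $n\in\mathbb{N}$, $n\ge 2$, such that $\mathcal{A}$ is the attractor of $(\tau_b)_{b\in B}$, with no overlap. (ii) There exists a finite set $C\subset\mathbb{Z}$ such that $A\oplus C=\{0,\dots,n-1\}$ for some positive integer $n$. Moreover, with $C$ and $n$ as in (ii), $\mathcal{A}$ tiles $\mathbb{R}$ by $C+n\mathbb{Z}$. In this case, $A+[0,1]$ is a spectral set.
   Context: The attractor of the system $(\tau_b)_{b\in B}$ is the unique nonempty compact set $X\subset\mathbb{R}$ with $X=\bigcup_{b\in B}\tau_b(X)$. "No overlap" means that for $b\neq b'$ in $B$ the set $\tau_b(X)\cap\tau_{b'}(X)$ has Lebesgue measure zero. The notation $A\oplus C=D$ means $D=A+C$ and every $d\in D$ can be written uniquely as $d=a+c$ with $a\in A$, $c\in C$. A measurable set $\Omega\subset\mathbb{R}$ tiles $\mathbb{R}$ by a set $\mathcal{T}\subset\mathbb{R}$ if $\mathbb{R}\setminus\bigcup_{t\in\mathcal{T}}(\Omega+t)$ has Lebesgue measure zero and $(\Omega+t)\cap(\Omega+t')$ has Lebesgue measure zero for all $t\neq t'$ in $\mathcal{T}$. A measurable set $\Omega\subset\mathbb{R}$ of positive finite Lebesgue measure is spectral if there is a set $\Lambda\subset\mathbb{R}$ such that the family of functions $e_\lambda(x)=e^{2\pi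 i\lambda x}$, $\lambda\in\Lambda$, is an orthogonal basis of $L^2(\Omega)$ (with Lebesgue measure). *)

theory Defs
  imports "HOL-Analysis.Analysis" "HOL-Library.Set_Algebras"
begin

definition invariant_compact :: "'i set \<Rightarrow> ('i \<Rightarrow> real \<Rightarrow> real) \<Rightarrow> real set \<Rightarrow> bool" where
  "invariant_compact B f X \<longleftrightarrow> X \<noteq> {} \<and> compact X \<and> X = (\<Union>b\<in>B. f b ` X)"

definition is_attractor :: "'i set \<Rightarrow> ('i \<Rightarrow> real \<Rightarrow> real) \<Rightarrow> real set \<Rightarrow> bool" where
  "is_attractor B f X \<longleftrightarrow>
     invariant_compact B f X \<and> (\<forall>Y. invariant_compact B f Y \<longrightarrow> Y = X)"

definition no_overlap :: "'i set \<Rightarrow> ('i \<Rightarrow> real \<Rightarrow> real) \<Rightarrow> real set \<Rightarrow> bool" where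
  "no_overlap B f X \<longleftrightarrow>
     (\<forall>b\<in>B. \<forall>b'\<in>B. b \<noteq> b' \<longrightarrow> f b ` X \<inter> f b' ` X \<in> null_sets lebesgue)"

definition affine_ifs :: "nat \<Rightarrow> int \<Rightarrow> real \<Rightarrow> real" where
  "affine_ifs n b x = 1 / real n * (x + real_of_int b)"

text \<open>\<open>direct_sum A C D\<close> is the relation \<open>A \<oplus> C = D\<close>; the sum of sets is the Minkowski sum.\<close>

definition direct_sum :: "'a::plus set \<Rightarrow> 'a set \<Rightarrow> 'a set \<Rightarrow> bool" where
  "direct_sum A C D \<longleftrightarrow>
     D = A + C \<and> (\<forall>d\<in>D. \<exists>!p. p \<in> A \<times> C \<and> d = fst p + snd p)"

definition tiles_by :: "real set \<Rightarrow> real set \<Rightarrow> bool" where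
  "tiles_by \<Omega> T \<longleftrightarrow>
     \<Omega> \<in> sets lebesgue \<and>
     UNIV - (\<Union>t\<in>T. (\<lambda>x. x + t) ` \<Omega>) \<in> null_sets lebesgue \<and>
     (\<forall>t\<in>T. \<forall>t'\<in>T. t \<noteq> t' \<longrightarrow>
        (\<lambda>x. x + t) ` \<Omega> \<inter> (\<lambda>x. x + t') ` \<Omega> \<in> null_sets lebesgue)"

text \<open>Elements of \<open>L\<^sup>2(M)\<close> are represented by functions rather than by classes modulo
  almost-everywhere equality, so \<open>L2_norm\<close> is a seminorm.\<close>

definition in_L2 :: "'a measure \<Rightarrow> ('a \<Rightarrow> complex) \<Rightarrow> bool" where
  "in_L2 M f \<longleftrightarrow> f \<in> borel_measurable M \<and> integrable M (\<lambda>x. (cmod (f x))\<^sup>2)"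

definition L2_inner :: "'a measure \<Rightarrow> ('a \<Rightarrow> complex) \<Rightarrow> ('a \<Rightarrow> complex) \<Rightarrow> complex" where
  "L2_inner M f g = (LINT x|M. f x * cnj (g x))"

definition L2_norm :: "'a measure \<Rightarrow> ('a \<Rightarrow> complex) \<Rightarrow> real" where
  "L2_norm M f = sqrt (LINT x|M. (cmod (f x))\<^sup>2)"

text \<open>An orthogonal basis of the Hilbert space \<open>L\<^sup>2(M)\<close>: nonzero, pairwise orthogonal elements
  whose finite linear combinations are dense.\<close>

definition orthogonal_basis_L2 :: "'a measure \<Rightarrow> 'i set \<Rightarrow> ('i \<Rightarrow> 'a \<Rightarrow> complex) \<Rightarrow> bool" where
  "orthogonal_basis_L2 M I e \<longleftrightarrow>
     (\<forall>i\<in>I. in_L2 M (e i) \<and> L2_norm M (e i) \<noteq> 0) \<and>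
     (\<forall>i\<in>I. \<forall>j\<in>I. i \<noteq> j \<longrightarrow> L2_inner M (e i) (e j) = 0) \<and>
     (\<forall>f. in_L2 M f \<longrightarrow> (\<forall>\<epsilon>>0. \<exists>F c. finite F \<and> F \<subseteq> I \<and>
        L2_norm M (\<lambda>x. f x - (\<Sum>i\<in>F. c i * e i x)) < \<epsilon>))"

definition exponential :: "real \<Rightarrow> real \<Rightarrow> complex" where
  "exponential l x = exp (2 * complex_of_real pi * \<i> * complex_of_real l * complex_of_real x)"

definition spectral_set :: "real set \<Rightarrow> bool" where
  "spectral_set \<Omega> \<longleftrightarrow>
     \<Omega> \<in> sets lebesgue \<and> 0 < emeasure lebesgue \<Omega> \<and> emeasure lebesgue \<Omega> < \<infinity> \<and>
     (\<exists>\<Lambda>. orthogonal_basis_L2 (lebesgue_on \<Omega>) \<Lambda> exponential)"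

definition plus_unit_interval :: "int set \<Rightarrow> real set" where
  "plus_unit_interval A = real_of_int ` A + {0..1}"

end

theory Submission
  imports Defs
begin

text \<open>
  Away from the null set of integers, a point lies in \<open>A + [0,1]\<close> iff its floor lies in \<open>A\<close>, so
  the invariance with no overlap says \<open>A \<oplus> B = n A \<oplus> {0..n - 1}\<close>. From \<open>A \<oplus> C = {0..n - 1}\<close> one
  takes \<open>B = n A \<oplus> C\<close>. Conversely, iteration shows that \<open>A\<close> tiles \<open>n\<^sup>k A \<oplus> {0..n\<^sup>k - 1}\<close> for all \<open>k\<close>;
  the maximal run of consecutive elements of \<open>A\<close> around 0 becomes an interval in this set whose
  distance from the rest exceeds the diameter of \<open>A\<close> for large \<open>k\<close>, so that a translate of
  \<open>A\<close> meeting the interval is contained in it.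

  For the spectrum, let \<open>A \<oplus> C = {0..n - 1}\<close> with least elements 0 and \<open>1 \<in> A\<close>, and let \<open>m\<close> be the least
  nonzero element of \<open>C\<close>. Then \<open>A = {0..m - 1} \<oplus> m A'\<close> and \<open>C = m C'\<close>, where \<open>A' \<oplus> C'\<close> is a shorter
  interval. By induction both factors have a finite spectrum: \<open>({0..m - 1} + G) / m\<close>
  for \<open>{0..m - 1} \<oplus> m A'\<close>, and \<open>G / m\<close> for \<open>m C'\<close>. If \<open>G\<close> is such a spectrum of \<open>A\<close>, then \<open>G + \<int>\<close> is a
  spectrum of \<open>A + [0,1]\<close>: inverting the exponential matrix writes \<open>f (x + a)\<close> as a combination of
  \<open>e\<^sub>g (x + a)\<close> with coefficients in \<open>L\<^sup>2[0,1]\<close>, which are approximated by trigonometric polynomials.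
\<close>

section \<open>Self-affine structure and tilings\<close>

lemma Ex1_unique: "\<exists>!x. P x \<Longrightarrow> P x \<Longrightarrow> P y \<Longrightarrow> x = y"
  by blast

lemma direct_sum_iff:
  "direct_sum A C D \<longleftrightarrow>
     (\<forall>a\<in>A. \<forall>c\<in>C. a + c \<in> D) \<and> (\<forall>d\<in>D. \<exists>a\<in>A. \<exists>c\<in>C. d = a + c) \<and>
     (\<forall>a\<in>A. \<forall>c\<in>C. \<forall>a'\<in>A. \<forall>c'\<in>C. a + c = a' + c' \<longrightarrow> a = a' \<and> c = c')"
  (is "_ \<longleftrightarrow> ?R")
proof
  assume L: "direct_sum A C D"
  then have D: "D = A + C" and ex1: "\<And>d. d \<in> D \<Longrightarrow> \<exists>!p. p \<in> A \<times> C \<and> d = fst p + snd p"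
    by (auto simp: direct_sum_def)
  have "a = a' \<and> c = c'"
    if "a \<in> A" "c \<in> C" "a' \<in> A" "c' \<in> C" "a + c = a' + c'" for a c a' c'
  proof -
    have "a + c \<in> D" using that D by (auto simp: set_plus_def)
    then have "(a, c) = (a', c')"
      using Ex1_unique[OF ex1, of "a + c" "(a, c)" "(a', c')"] that by simp
    then show ?thesis by simp
  qed
  then show ?R using D by (auto simp: set_plus_def)
next
  assume R: ?R
  then have "D = A + C" by (fastforce simp: set_plus_def)
  moreover have "\<exists>!p. p \<in> A \<times> C \<and> d = fst p + snd p" if d: "d \<in> D" for d
  proof -
    obtain a c where ac: "a \<in> A" "c \<in> C" "d = a + c" using R d by blast
    show ?thesis
    proof (rule ex1I[of _ "(a, c)"])
      show "(a, c) \<in> A \<times> C \<and> d = fst (a, c) + snd (a, c)" using ac by simp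
      fix p assume "p \<in> A \<times> C \<and> d = fst p + snd p"
      then show "p = (a, c)" using R ac by (cases p) (simp, metis)
    qed
  qed
  ultimately show "direct_sum A C D" by (simp add: direct_sum_def)
qed

lemma direct_sum_mem: "direct_sum A C D \<Longrightarrow> a \<in> A \<Longrightarrow> c \<in> C \<Longrightarrow> a + c \<in> D"
  by (simp add: direct_sum_iff)

lemma direct_sumE:
  assumes "direct_sum A C D" "d \<in> D"
  obtains a c where "a \<in> A" "c \<in> C" "d = a + c"
  using assms by (auto simp: direct_sum_iff)

lemma direct_sum_unique:
  assumes "direct_sum A C D" "a \<in> A" "c \<in> C" "a' \<in> A" "c' \<in> C" "a + c = a' + c'"
  shows "a = a'" "c = c'"
  using assms unfolding direct_sum_iff by blast+

lemma direct_sumI: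
  assumes "\<And>a c. a \<in> A \<Longrightarrow> c \<in> C \<Longrightarrow> a + c \<in> D"
    and "\<And>d. d \<in> D \<Longrightarrow> \<exists>a\<in>A. \<exists>c\<in>C. d = a + c"
    and "\<And>a c a' c'. a \<in> A \<Longrightarrow> c \<in> C \<Longrightarrow> a' \<in> A \<Longrightarrow> c' \<in> C \<Longrightarrow> a + c = a' + c' \<Longrightarrow> a = a' \<and> c = c'"
  shows "direct_sum A C D"
  unfolding direct_sum_iff using assms by blast

text \<open>\<open>refine n D\<close> is \<open>n D \<oplus> {0..n - 1}\<close>.\<close>

definition refine :: "int \<Rightarrow> int set \<Rightarrow> int set" where
  "refine n D = {x. x div n \<in> D}"

text \<open>Tilings compose: \<open>refine N A\<close> splits into translates \<open>A + c\<close>,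
  so \<open>refine (n * N) A\<close> splits into the sets \<open>refine n A + n * c\<close>, and
  each of these splits by \<open>B\<close>.\<close>

lemma direct_sum_refine:
  fixes n :: int
  assumes n: "n > 0" and AB: "direct_sum A B (refine n A)" and AC: "direct_sum A C (refine N A)"
    and N: "N \<ge> 0"
  shows "direct_sum A ((\<lambda>(b, c). b + n * c) ` (B \<times> C)) (refine (n * N) A)"
proof (rule direct_sumI)
  have shift: "(y + n * c) div n = y div n + c" for y c :: int using n by simp
  have dd: "x div (n * N) = x div n div N" for x :: int
    using n N by (simp add: zdiv_zmult2_eq)
  show "a + d \<in> refine (n * N) A" if "a \<in> A" "d \<in> (\<lambda>(b, c). b + n * c) ` (B \<times> C)" for a d
  proof -
    obtain b c where bc: "b \<in> B" "c \<in> C" "d = b + n * c" using \<open>d \<in> _\<close> by auto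
    have "(a + b) div n \<in> A" using direct_sum_mem[OF AB \<open>a \<in> A\<close> bc(1)] by (simp add: refine_def)
    then have "(a + b) div n + c \<in> refine N A" using direct_sum_mem[OF AC] bc by blast
    then show ?thesis using shift[of "a + b" c] by (simp add: refine_def dd bc add.assoc)
  qed
  show "\<exists>a\<in>A. \<exists>d\<in>(\<lambda>(b, c). b + n * c) ` (B \<times> C). x = a + d" if "x \<in> refine (n * N) A" for x
  proof -
    have "x div n \<in> refine N A" using that by (simp add: refine_def dd)
    then obtain a c where ac: "a \<in> A" "c \<in> C" "x div n = a + c" by (rule direct_sumE[OF AC])
    have "x - n * c \<in> refine n A" using ac shift[of x "-c"] by (simp add: refine_def)
    then obtain a' b where "a' \<in> A" "b \<in> B" "x - n * c = a' + b" by (rule direct_sumE[OF AB])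
    then show ?thesis using ac by (intro bexI[of _ a'] bexI[of _ "b + n * c"]) auto
  qed
  show "a = a' \<and> d = d'"
    if A: "a \<in> A" "a' \<in> A" and d: "d \<in> (\<lambda>(b, c). b + n * c) ` (B \<times> C)"
      and d': "d' \<in> (\<lambda>(b, c). b + n * c) ` (B \<times> C)" and eq: "a + d = a' + d'" for a d a' d'
  proof -
    obtain b c where bc: "b \<in> B" "c \<in> C" "d = b + n * c" using d by auto
    obtain b' c' where bc': "b' \<in> B" "c' \<in> C" "d' = b' + n * c'" using d' by auto
    have "(a + b) div n \<in> A" "(a' + b') div n \<in> A"
      using direct_sum_mem[OF AB] A bc bc' by (simp_all add: refine_def)
    moreover have "(a + b) div n + c = (a' + b') div n + c'"
      using eq shift[of "a + b" c] shift[of "a' + b'" c'] bc bc' by (simp add: algebra_simps)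
    ultimately have "c = c'" using direct_sum_unique(2)[OF AC] bc bc' by blast
    with eq bc bc' have "a + b = a' + b'" by simp
    then have "a = a'" "b = b'" using direct_sum_unique[OF AB] A bc bc' by blast+
    then show ?thesis using \<open>c = c'\<close> bc bc' by simp
  qed
qed

lemma tileable_refine_power:
  fixes n :: int
  assumes "n > 0" "direct_sum A B (refine n A)"
  shows "\<exists>C. direct_sum A C (refine (n ^ k) A)"
proof (induction k)
  case 0
  have "direct_sum A {0} (refine 1 A)" by (auto simp: direct_sum_iff refine_def)
  then show ?case by auto
next
  case (Suc k)
  then obtain C where "direct_sum A C (refine (n ^ k) A)" by blast
  from direct_sum_refine[OF assms this] show ?case using assms(1) by auto
qed

section \<open>Cutting an interval out of a tiling\<close>

lemma exists_first_gap:
  fixes A :: "int set"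
  assumes "finite A" "0 \<in> A"
  obtains u where "u \<ge> 0" "{0..u} \<subseteq> A" "u + 1 \<notin> A"
proof -
  have "\<exists>k. int k \<notin> A"
  proof (rule ccontr)
    assume "\<nexists>k. int k \<notin> A"
    then have "range int \<subseteq> A" by auto
    then show False using assms(1) finite_subset by (metis finite_imageD infinite_UNIV_nat inj_of_nat)
  qed
  define k where "k = (LEAST k. int k \<notin> A)"
  have k: "int k \<notin> A" using \<open>\<exists>k. _\<close> unfolding k_def by (rule LeastI_ex)
  have lt: "int j \<in> A" if "j < k" for j using not_less_Least that unfolding k_def by blast
  have "k > 0" using k assms(2) by (cases k) auto
  show thesis
  proof (rule that[of "int k - 1"])
    show "int k - 1 \<ge> 0" using \<open>k > 0\<close> by simp
    show "{0..int k - 1} \<subseteq> A"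
    proof
      fix x assume "x \<in> {0..int k - 1}"
      then show "x \<in> A" using lt[of "nat x"] by auto
    qed
  qed (use k in simp)
qed

lemma le_div_iff_int:
  fixes N :: int
  assumes "N > 0"
  shows "k \<le> x div N \<longleftrightarrow> k * N \<le> x"
proof
  assume "k \<le> x div N"
  then have "k * N \<le> (x div N) * N" using assms by simp
  also have "\<dots> \<le> x" using assms div_mult_mod_eq[of x N] pos_mod_sign[of N x] by linarith
  finally show "k * N \<le> x" .
next
  assume "k * N \<le> x"
  from zdiv_mono1[OF this assms] show "k \<le> x div N" using assms by simp
qed

text \<open>The run of \<open>A\<close> through 0 turns into an interval of
  \<open>refine N A\<close>. On either side a whole block of \<open>N\<close> integers is missing,
  which no translate of \<open>A\<close> can bridge, so the translates meeting the interval tile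
  it.\<close>

lemma tile_interval_if_tile_refine:
  fixes A :: "int set" and N :: int
  assumes fin: "finite A" and 0: "0 \<in> A" and N: "N > 0"
    and diam: "\<And>a a'. a \<in> A \<Longrightarrow> a' \<in> A \<Longrightarrow> a' - a < N"
    and AC: "direct_sum A C (refine N A)"
  shows "\<exists>C' (m::nat). finite C' \<and> m > 0 \<and> direct_sum A C' {0..int m - 1}"
proof -
  \<comment> \<open>The maximal run of consecutive elements through 0 is \<open>{- l..u}\<close>;
    its left end comes from the first gap of \<open>- A\<close>.\<close>
  obtain u where u: "u \<ge> 0" "{0..u} \<subseteq> A" "u + 1 \<notin> A" using exists_first_gap[OF fin 0] .
  obtain l where l: "l \<ge> 0" "{0..l} \<subseteq> uminus ` A" "l + 1 \<notin> uminus ` A"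
    using exists_first_gap[of "uminus ` A"] fin 0 by force
  have l1: "- l - 1 \<notin> A" using l(3) by force
  have run: "q \<in> A" if "- l \<le> q" "q \<le> u" for q
  proof (cases "q \<ge> 0")
    case True then show ?thesis using u that by auto
  next
    case False
    then have "- q \<in> uminus ` A" using l that by auto
    then show ?thesis by auto
  qed
  define m where "m = (u + 1 + l) * N"
  \<comment> \<open>Adding \<open>l * N\<close> moves the left end of the interval, which is
    \<open>- l * N\<close>, to 0.\<close>
  have block: "x + l * N \<in> {0..m - 1} \<longleftrightarrow> - l \<le> x div N \<and> x div N \<le> u" for x
  proof -
    have "- l \<le> x div N \<longleftrightarrow> - l * N \<le> x" by (rule le_div_iff_int[OF N])
    moreover have "x div N \<le> u \<longleftrightarrow> x < (u + 1) * N" using le_div_iff_int[OF N, of "u + 1" x] by linarith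
    ultimately show ?thesis by (auto simp: m_def algebra_simps)
  qed
  \<comment> \<open>Only one point of \<open>A + d\<close> is required to lie in the interval;
    \<open>sub\<close> extends this to all points.\<close>
  define C' where "C' = {d. d - l * N \<in> C \<and> (\<exists>a\<in>A. a + d \<in> {0..m - 1})}"
  \<comment> \<open>Two points of a translate of \<open>A\<close> differ by less than
    \<open>N\<close>, so their quotients differ by at most 1. Leaving the interval would therefore
    give the quotient \<open>- l - 1\<close> or \<open>u + 1\<close>, and neither is in
    \<open>A\<close>.\<close>
  have sub: "a' + d \<in> {0..m - 1}"
    if a': "a' \<in> A" and d: "d - l * N \<in> C" and a: "a \<in> A" "a + d \<in> {0..m - 1}" for a a' d
  proof -
    let ?c = "d - l * N"
    have x: "- l \<le> (a + ?c) div N" "(a + ?c) div N \<le> u" using block[of "a + ?c"] a by auto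
    have q: "(a' + ?c) div N \<in> A" using direct_sum_mem[OF AC a' d] by (simp add: refine_def)
    have "a' + ?c \<le> (a + ?c) + N" "a + ?c - N \<le> a' + ?c"
      using diam[OF a(1) a'] diam[OF a' a(1)] by auto
    moreover have "(a + ?c) div N * N \<le> a + ?c" "(a' + ?c) div N * N \<le> a' + ?c"
      by (simp_all flip: le_div_iff_int[OF N])
    ultimately have "((a' + ?c) div N - 1) * N \<le> a + ?c" "((a + ?c) div N - 1) * N \<le> a' + ?c"
      unfolding left_diff_distrib by linarith+
    then have "(a' + ?c) div N \<le> (a + ?c) div N + 1" "(a + ?c) div N - 1 \<le> (a' + ?c) div N"
      unfolding le_div_iff_int[OF N, symmetric] by linarith+
    then have "- l - 1 \<le> (a' + ?c) div N" "(a' + ?c) div N \<le> u + 1" using x by auto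
    moreover have "(a' + ?c) div N \<noteq> - l - 1" "(a' + ?c) div N \<noteq> u + 1" using q l1 u(3) by auto
    ultimately show ?thesis using block[of "a' + ?c"] by auto
  qed
  have "direct_sum A C' {0..m - 1}"
  proof (rule direct_sumI)
    show "a + d \<in> {0..m - 1}" if "a \<in> A" "d \<in> C'" for a d
      using that unfolding C'_def by (blast intro: sub)
    show "\<exists>a\<in>A. \<exists>d\<in>C'. x = a + d" if x: "x \<in> {0..m - 1}" for x
    proof -
      have "x - l * N \<in> refine N A" using block[of "x - l * N"] x run[of "(x - l * N) div N"] by (simp add: refine_def)
      then obtain a c where ac: "a \<in> A" "c \<in> C" "x - l * N = a + c" by (rule direct_sumE[OF AC])
      have "c + l * N \<in> C'" unfolding C'_def
      proof (intro CollectI conjI bexI[of _ a])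
        show "a + (c + l * N) \<in> {0..m - 1}" using ac x by (simp add: algebra_simps)
      qed (use ac in simp_all)
      then show ?thesis using ac by (intro bexI[of _ a] bexI[of _ "c + l * N"]) simp_all
    qed
    show "a = a' \<and> d = d'" if "a \<in> A" "d \<in> C'" "a' \<in> A" "d' \<in> C'" "a + d = a' + d'" for a d a' d'
      using direct_sum_unique[OF AC, of a "d - l * N" a' "d' - l * N"] that by (auto simp: C'_def)
  qed
  \<comment> \<open>Since \<open>0 \<in> A\<close>, each \<open>d\<close> in \<open>C'\<close> is
    itself a point of the interval.\<close>
  moreover have "finite C'"
    using 0 sub by (intro finite_subset[of C' "{0..m - 1}"]) (auto simp: C'_def dest: sub[OF 0])
  moreover have "m > 0" using u l N by (simp add: m_def)
  ultimately show ?thesis by (intro exI[of _ C'] exI[of _ "nat m"]) auto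
qed

section \<open>The set \<open>A + [0, 1]\<close>, its images under the system, and
  attractors\<close>

lemma mem_plus_unit_interval:
  "x \<in> plus_unit_interval A \<longleftrightarrow> (\<exists>a\<in>A. real_of_int a \<le> x \<and> x \<le> real_of_int a + 1)"
proof
  assume "\<exists>a\<in>A. real_of_int a \<le> x \<and> x \<le> real_of_int a + 1"
  then obtain a where "a \<in> A" "real_of_int a \<le> x" "x \<le> real_of_int a + 1" by blast
  then show "x \<in> plus_unit_interval A"
    unfolding plus_unit_interval_def
    by (auto simp: set_plus_def intro!: bexI[of _ a] bexI[of _ "x - real_of_int a"])
qed (force simp: plus_unit_interval_def set_plus_def)

text \<open>The bridge between real and integer sets: a point that is not an integer lies in a
  single cell \<open>[a, a + 1]\<close>. An integer may lie in \<open>A + [0, 1]\<close> through the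
  cell on its left alone, and integers form a null set.\<close>

lemma mem_plus_unit_interval_floor:
  assumes "x \<notin> \<int>"
  shows "x \<in> plus_unit_interval A \<longleftrightarrow> \<lfloor>x\<rfloor> \<in> A"
proof
  assume "x \<in> plus_unit_interval A"
  then obtain a where a: "a \<in> A" "real_of_int a \<le> x" "x \<le> real_of_int a + 1"
    by (auto simp: mem_plus_unit_interval)
  moreover have "x \<noteq> real_of_int a + 1" using assms by auto
  ultimately have "\<lfloor>x\<rfloor> = a" by linarith
  then show "\<lfloor>x\<rfloor> \<in> A" using a by simp
next
  assume "\<lfloor>x\<rfloor> \<in> A"
  then show "x \<in> plus_unit_interval A"
    unfolding mem_plus_unit_interval by (intro bexI[of _ "\<lfloor>x\<rfloor>"]) linarith+
qed

lemma compact_plus_unit_interval: "finite A \<Longrightarrow> compact (plus_unit_interval A)"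
proof -
  assume "finite A"
  moreover have "plus_unit_interval A = (\<Union>a\<in>A. {real_of_int a..real_of_int a + 1})"
    by (auto simp: mem_plus_unit_interval)
  ultimately show ?thesis by (simp add: compact_UN)
qed

lemma null_sets_lebesgue_countable: "countable (N::real set) \<Longrightarrow> N \<in> null_sets lebesgue"
  by (simp add: countable_imp_null_set_lborel null_sets_completionI)

lemma Ioo_notin_null_sets:
  fixes a b :: real assumes "a < b" "{a<..<b} \<subseteq> N" shows "N \<notin> null_sets lebesgue"
proof
  assume "N \<in> null_sets lebesgue"
  then have "negligible {a<..<b}" using assms(2) negligible_iff_null_sets negligible_subset by blast
  then show False using assms(1) negligible_interval(2)[of a b] by (simp add: box_real)
qed

lemma affine_ifs_image:
  assumes "n > 0"
  shows "x \<in> affine_ifs n b ` X \<longleftrightarrow> real n * x - real_of_int b \<in> X"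
proof
  assume "real n * x - real_of_int b \<in> X"
  moreover have "x = affine_ifs n b (real n * x - real_of_int b)"
    using assms by (simp add: affine_ifs_def)
  ultimately show "x \<in> affine_ifs n b ` X" by blast
qed (use assms in \<open>auto simp: affine_ifs_def\<close>)

text \<open>With \<open>x = n q + r\<close> and \<open>r \<le> n - 1\<close>, adding
  \<open>t < 1\<close> does not reach the next multiple of \<open>n\<close>.\<close>

lemma floor_divide_int:
  assumes "n > 0" "0 < t" "t < 1"
  shows "\<lfloor>(real_of_int x + t) / real n\<rfloor> = x div int n" "(real_of_int x + t) / real n \<notin> \<int>"
proof -
  let ?q = "x div int n" and ?r = "x mod int n"
  have x: "x = int n * ?q + ?r" by simp
  have r: "0 \<le> ?r" "?r \<le> int n - 1" using assms by auto
  have "real_of_int x = real n * real_of_int ?q + real_of_int ?r"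
    using x by (metis of_int_add of_int_mult of_int_of_nat_eq)
  then have eq: "(real_of_int x + t) / real n = real_of_int ?q + (real_of_int ?r + t) / real n"
    using assms by (simp add: field_simps)
  have "real_of_int ?r \<le> real n - 1" using r by linarith
  then have fr: "0 < (real_of_int ?r + t) / real n" "(real_of_int ?r + t) / real n < 1"
  proof -
    have "0 \<le> real_of_int ?r" using r by simp
    then show "0 < (real_of_int ?r + t) / real n" using assms by (intro divide_pos_pos) linarith+
    show "(real_of_int ?r + t) / real n < 1" using \<open>real_of_int ?r \<le> _\<close> assms by simp
  qed
  show fl: "\<lfloor>(real_of_int x + t) / real n\<rfloor> = ?q" unfolding eq using fr by linarith
  show "(real_of_int x + t) / real n \<notin> \<int>"
    using fl eq fr by (auto elim!: Ints_cases)
qed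

text \<open>Tested on the cells of length \<open>1 / n\<close>: cell number \<open>x\<close> belongs
  to \<open>A + [0, 1]\<close> iff \<open>x div n \<in> A\<close>, and to the image under
  \<open>b\<close> iff \<open>x - b \<in> A\<close>.\<close>

lemma direct_sum_if_invariant:
  assumes n: "n > 0" and inv: "plus_unit_interval A = (\<Union>b\<in>B. affine_ifs n b ` plus_unit_interval A)"
    and no: "no_overlap B (affine_ifs n) (plus_unit_interval A)"
  shows "direct_sum A B (refine (int n) A)"
proof -
  have mem: "(real_of_int x + t) / real n \<in> affine_ifs n b ` plus_unit_interval A \<longleftrightarrow> x - b \<in> A"
    if t: "0 < t" "t < 1" for x b and t :: real
  proof -
    have fl: "\<lfloor>real_of_int x + t - real_of_int b\<rfloor> = x - b" using t by linarith
    have "real_of_int x + t - real_of_int b \<notin> \<int>"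
    proof
      assume "real_of_int x + t - real_of_int b \<in> \<int>"
      then obtain z where "real_of_int x + t - real_of_int b = real_of_int z" by (elim Ints_cases)
      then have "t = real_of_int (z - x + b)" by simp
      then have "0 < z - x + b" "z - x + b < 1" using t by linarith+
      then show False by simp
    qed
    then show ?thesis using n fl by (simp add: affine_ifs_image mem_plus_unit_interval_floor)
  qed
  have mem': "x div int n \<in> A \<longleftrightarrow> (\<exists>b\<in>B. x - b \<in> A)" for x
  proof -
    \<comment> \<open>The midpoint represents its cell; any interior point would do.\<close>
    let ?y = "(real_of_int x + 1 / 2) / real n"
    have "x div int n \<in> A \<longleftrightarrow> ?y \<in> plus_unit_interval A"
      using mem_plus_unit_interval_floor[OF floor_divide_int(2)[OF n, of "1/2" x], of A]
        floor_divide_int(1)[OF n, of "1/2" x] by simp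
    also have "\<dots> \<longleftrightarrow> (\<exists>b\<in>B. ?y \<in> affine_ifs n b ` plus_unit_interval A)" using inv by blast
    also have "\<dots> \<longleftrightarrow> (\<exists>b\<in>B. x - b \<in> A)" using mem[of "1/2" x] by simp
    finally show ?thesis .
  qed
  show ?thesis
  proof (rule direct_sumI)
    show "a + b \<in> refine (int n) A" if "a \<in> A" "b \<in> B" for a b
      using mem'[of "a + b"] that by (auto simp: refine_def intro!: bexI[of _ b])
    show "\<exists>a\<in>A. \<exists>b\<in>B. x = a + b" if "x \<in> refine (int n) A" for x
      using mem'[of x] that by (force simp: refine_def)
    show "a = a' \<and> b = b'" if "a \<in> A" "b \<in> B" "a' \<in> A" "b' \<in> B" "a + b = a' + b'" for a b a' b'
    proof (cases "b = b'")
      case False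
      let ?x = "real_of_int (a + b)"
      \<comment> \<open>Two representations of one integer make the two images share a whole open
        cell, which has positive measure.\<close>
      have "{?x / n<..<(?x + 1) / n} \<subseteq>
          affine_ifs n b ` plus_unit_interval A \<inter> affine_ifs n b' ` plus_unit_interval A"
      proof
        fix y assume "y \<in> {?x / n<..<(?x + 1) / n}"
        then have "0 < real n * y - ?x" "real n * y - ?x < 1" using n by (auto simp: field_simps)
        from mem[OF this, of "a + b"] have "y \<in> affine_ifs n e ` plus_unit_interval A \<longleftrightarrow> a + b - e \<in> A" for e
          using n by simp
        moreover have "a + b - b \<in> A" "a + b - b' \<in> A" using that(1,3) by (simp, subst that(5), simp)
        ultimately show "y \<in> affine_ifs n b ` plus_unit_interval A \<inter> affine_ifs n b' ` plus_unit_interval A"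
          by blast
      qed
      from Ioo_notin_null_sets[OF _ this] n
      have "affine_ifs n b ` plus_unit_interval A \<inter> affine_ifs n b' ` plus_unit_interval A \<notin> null_sets lebesgue"
        by (simp add: field_simps)
      then show ?thesis using no False that by (auto simp: no_overlap_def)
    qed (use that in simp)
  qed
qed

text \<open>The equality must hold at every point, integers included, so closed cells replace the
  floor criterion here.\<close>

lemma invariant_if_direct_sum:
  assumes n: "n > 0" and AB: "direct_sum A B (refine (int n) A)"
  shows "plus_unit_interval A = (\<Union>b\<in>B. affine_ifs n b ` plus_unit_interval A)" (is "?P = ?U")
proof (intro equalityI subsetI)
  fix x assume "x \<in> ?P"
  then obtain a where a: "a \<in> A" "real_of_int a \<le> x" "x \<le> real_of_int a + 1"
    by (auto simp: mem_plus_unit_interval)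
  have na: "real n * real_of_int a \<le> real n * x" "real n * x \<le> real n * real_of_int a + real n"
    using n a mult_left_mono[of x "real_of_int a + 1" "real n"] by (auto simp: algebra_simps)
  \<comment> \<open>The index of a cell containing \<open>n x\<close>. At the right end
    \<open>x = a + 1\<close> the floor belongs to the next block, and the minimum steps back to the
    last cell of block \<open>a\<close>.\<close>
  define d where "d = min \<lfloor>real n * x\<rfloor> (int n * a + int n - 1)"
  have "int n * a \<le> \<lfloor>real n * x\<rfloor>" using na by (simp add: le_floor_iff)
  then have d1: "int n * a \<le> d" "d < int n * a + int n" using n by (auto simp: d_def)
  have d2: "real_of_int d \<le> real n * x" "real n * x \<le> real_of_int d + 1"
  proof -
    have *: "real_of_int (int n * a + int n - 1) = real n * real_of_int a + real n - 1" by simp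
    show "real_of_int d \<le> real n * x" unfolding d_def by linarith
    show "real n * x \<le> real_of_int d + 1"
      using na * real_of_int_floor_add_one_ge[of "real n * x"] unfolding d_def min_def by auto
  qed
  have "d div int n = a" using d1 by (intro int_div_pos_eq[of _ _ _ "d - int n * a"]) auto
  then have "d \<in> refine (int n) A" using a by (simp add: refine_def)
  then obtain a' b where "a' \<in> A" "b \<in> B" "d = a' + b" by (rule direct_sumE[OF AB])
  then have "real n * x - real_of_int b \<in> ?P" using d2
    unfolding mem_plus_unit_interval by (intro bexI[of _ a']) auto
  then show "x \<in> ?U" using n \<open>b \<in> B\<close> by (auto simp: affine_ifs_image)
next
  fix x assume "x \<in> ?U"
  then obtain b where b: "b \<in> B" "real n * x - real_of_int b \<in> ?P" using n by (auto simp: affine_ifs_image)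
  then obtain a' where a': "a' \<in> A" "real_of_int a' \<le> real n * x - real_of_int b"
    "real n * x - real_of_int b \<le> real_of_int a' + 1" by (auto simp: mem_plus_unit_interval)
  let ?d = "a' + b"
  let ?a = "?d div int n"
  have "?a \<in> A" using direct_sum_mem[OF AB a'(1) b(1)] by (simp add: refine_def)
  moreover have r: "0 \<le> ?d mod int n" "?d mod int n \<le> int n - 1" using n by auto
  have "int n * ?a \<le> ?d" "?d + 1 \<le> int n * ?a + int n"
    using r mult_div_mod_eq[of "int n" ?d] by linarith+
  then have "real_of_int (int n * ?a) \<le> real_of_int ?d" "real_of_int (?d + 1) \<le> real_of_int (int n * ?a + int n)"
    by (simp_all only: of_int_le_iff)
  then have "real n * real_of_int ?a \<le> real n * x" "real n * x \<le> real n * (real_of_int ?a + 1)"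
    using a' unfolding distrib_left of_int_add of_int_mult of_int_of_nat_eq of_int_1 by linarith+
  then have "real_of_int ?a \<le> x" "x \<le> real_of_int ?a + 1"
    using n by (simp_all only: mult_le_cancel_left_pos of_nat_0_less_iff)
  ultimately show "x \<in> ?P" by (auto simp: mem_plus_unit_interval)
qed

text \<open>Where \<open>n x\<close> is not an integer, its floor would split as an element of
  \<open>A\<close> plus \<open>b\<close> and also as one plus \<open>b'\<close>. So the overlap
  consists of integer multiples of \<open>1 / n\<close>.\<close>

lemma no_overlap_if_direct_sum:
  assumes n: "n > 0" and AB: "direct_sum A B (refine (int n) A)"
  shows "no_overlap B (affine_ifs n) (plus_unit_interval A)"
  unfolding no_overlap_def
proof (intro ballI impI)
  fix b b' assume b: "b \<in> B" "b' \<in> B" "b \<noteq> b'"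
  have "affine_ifs n b ` plus_unit_interval A \<inter> affine_ifs n b' ` plus_unit_interval A \<subseteq> (\<lambda>y. y / real n) ` \<int>"
  proof
    fix x assume "x \<in> affine_ifs n b ` plus_unit_interval A \<inter> affine_ifs n b' ` plus_unit_interval A"
    then have P: "real n * x - real_of_int b \<in> plus_unit_interval A" "real n * x - real_of_int b' \<in> plus_unit_interval A"
      using n by (auto simp: affine_ifs_image)
    have "real n * x \<in> \<int>"
    proof (rule ccontr)
      assume nx: "real n * x \<notin> \<int>"
      have "real n * x - real_of_int b \<notin> \<int>" for b using nx by (metis Ints_add Ints_of_int diff_add_cancel)
      then have "\<lfloor>real n * x - real_of_int b\<rfloor> \<in> A" "\<lfloor>real n * x - real_of_int b'\<rfloor> \<in> A"
        using P mem_plus_unit_interval_floor by blast+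
      then show False using direct_sum_unique(2)[OF AB _ b(1) _ b(2)] b(3) by fastforce
    qed
    then show "x \<in> (\<lambda>y. y / real n) ` \<int>" using n by (intro image_eqI[of _ _ "real n * x"]) auto
  qed
  moreover have "countable ((\<lambda>y. y / real n) ` \<int>)" by (simp add: Ints_def)
  ultimately show "affine_ifs n b ` plus_unit_interval A \<inter> affine_ifs n b' ` plus_unit_interval A \<in> null_sets lebesgue"
    using countable_subset null_sets_lebesgue_countable by blast
qed

text \<open>At a point of \<open>X\<close> farthest from \<open>Y\<close>, contraction by
  \<open>1 / n \<le> 1 / 2\<close> bounds the largest distance by half of itself, so it is 0.
  Exchanging \<open>X\<close> and \<open>Y\<close> gives uniqueness of the attractor.\<close>

lemma invariant_compact_subset:
  assumes n: "n \<ge> 2" and X: "invariant_compact B (affine_ifs n) X" and Y: "invariant_compact B (affine_ifs n) Y"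
  shows "X \<subseteq> Y"
proof -
  have X': "compact X" "X \<noteq> {}" "X = (\<Union>b\<in>B. affine_ifs n b ` X)"
    and Y': "compact Y" "Y \<noteq> {}" "Y = (\<Union>b\<in>B. affine_ifs n b ` Y)"
    using X Y by (auto simp: invariant_compact_def)
  have "continuous_on X (\<lambda>x. infdist x Y)" by (intro continuous_intros)
  then obtain x0 where x0: "x0 \<in> X" "\<And>x. x \<in> X \<Longrightarrow> infdist x Y \<le> infdist x0 Y"
    using continuous_attains_sup[OF X'(1,2)] by blast
  obtain b x where bx: "b \<in> B" "x \<in> X" "x0 = affine_ifs n b x" using X'(3) x0(1) by blast
  obtain y where y: "y \<in> Y" "infdist x Y = dist x y"
    using infdist_attains_inf[OF compact_imp_closed[OF Y'(1)] Y'(2)] by blast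
  have "affine_ifs n b y \<in> Y" using Y'(3) bx y by blast
  then have "infdist x0 Y \<le> dist x0 (affine_ifs n b y)" by (rule infdist_le)
  also have "\<dots> = dist x y / real n"
    using n by (simp add: bx affine_ifs_def dist_real_def abs_divide flip: diff_divide_distrib)
  also have "\<dots> \<le> infdist x0 Y / 2"
    using n x0(2)[OF bx(2)] y infdist_nonneg[of x0 Y] by (intro frac_le) auto
  finally have "infdist x0 Y \<le> 0" by simp
  then have "infdist x Y = 0" if "x \<in> X" for x
    using x0(2)[OF that] infdist_nonneg[of x Y] by linarith
  then show ?thesis using in_closed_iff_infdist_zero[OF compact_imp_closed[OF Y'(1)] Y'(2)] by blast
qed

text \<open>The tiling is iterated until \<open>n ^ k\<close> exceeds the diameter \<open>d\<close>
  of \<open>A\<close>; then the run through 0 is isolated.\<close>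

lemma tileable_if_attractor:
  fixes A B :: "int set"
  assumes fin: "finite A" and 0: "0 \<in> A" and n: "n \<ge> 2"
    and att: "is_attractor B (affine_ifs n) (plus_unit_interval A)"
    and no: "no_overlap B (affine_ifs n) (plus_unit_interval A)"
  shows "\<exists>C (m::nat). finite C \<and> m > 0 \<and> direct_sum A C {0..int m - 1}"
proof -
  have n0: "n > 0" "int n > 0" using n by simp_all
  have "direct_sum A B (refine (int n) A)"
    using direct_sum_if_invariant[OF n0(1) _ no] att
    by (simp add: is_attractor_def invariant_compact_def)
  note tile = tileable_refine_power[OF n0(2) this]
  define d where "d = Max ((\<lambda>(a, a'). a' - a) ` (A \<times> A))"
  have d: "a' - a \<le> d" if "a \<in> A" "a' \<in> A" for a a'
    unfolding d_def using fin that by (intro Max_ge) force+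
  obtain k where k: "real_of_int d < 2 ^ k" using real_arch_pow[of 2 "real_of_int d"] by auto
  then have "d < 2 ^ k" by (metis of_int_less_iff of_int_numeral of_int_power)
  also have "2 ^ k \<le> int n ^ k" using n by (intro power_mono) auto
  finally have "d < int n ^ k" .
  then have "a' - a < int n ^ k" if "a \<in> A" "a' \<in> A" for a a' using d[OF that] by linarith
  moreover obtain C where "direct_sum A C (refine (int n ^ k) A)" using tile by blast
  ultimately show ?thesis using n0 by (intro tile_interval_if_tile_refine[OF fin 0]) auto
qed

text \<open>Regrouping: \<open>n A \<oplus> {0..n - 1} = n A \<oplus> (A \<oplus> C) = A \<oplus> (n
  A \<oplus> C)\<close>.\<close>

lemma direct_sum_refine_if_interval:
  fixes A C :: "int set"
  assumes n: "n > 0" and AC: "direct_sum A C {0..int n - 1}"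
  shows "direct_sum A ((\<lambda>(a, c). int n * a + c) ` (A \<times> C)) (refine (int n) A)"
proof (rule direct_sumI)
  have qr: "(int n * q + r) div int n = q" if "r \<in> {0..int n - 1}" for q r
    using that n by (intro int_div_pos_eq[of _ _ _ r]) auto
  show "a + b \<in> refine (int n) A" if "a \<in> A" "b \<in> (\<lambda>(a, c). int n * a + c) ` (A \<times> C)" for a b
  proof -
    obtain a' c where ac: "a' \<in> A" "c \<in> C" "b = int n * a' + c"
      using \<open>b \<in> _\<close> by auto
    have "a + c \<in> {0..int n - 1}" using direct_sum_mem[OF AC] ac that by blast
    then show ?thesis using qr[of "a + c" a'] ac by (simp add: refine_def algebra_simps)
  qed
  show "\<exists>a\<in>A. \<exists>b\<in>(\<lambda>(a, c). int n * a + c) ` (A \<times> C). x = a + b" if "x \<in> refine (int n) A" for x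
  proof -
    have "x mod int n \<in> {0..int n - 1}" using n by auto
    then obtain a c where ac: "a \<in> A" "c \<in> C" "x mod int n = a + c" by (rule direct_sumE[OF AC])
    have "x = a + (int n * (x div int n) + c)" using mult_div_mod_eq[of "int n" x] ac by linarith
    then show ?thesis using ac that
      by (intro bexI[of _ a] bexI[of _ "int n * (x div int n) + c"]) (auto simp: refine_def)
  qed
  show "a = a' \<and> b = b'"
    if A: "a \<in> A" "a' \<in> A" and b: "b \<in> (\<lambda>(a, c). int n * a + c) ` (A \<times> C)"
      "b' \<in> (\<lambda>(a, c). int n * a + c) ` (A \<times> C)" and eq: "a + b = a' + b'" for a b a' b'
  proof -
    obtain e c where ec: "e \<in> A" "c \<in> C" "b = int n * e + c" using b by auto
    obtain e' c' where ec': "e' \<in> A" "c' \<in> C" "b' = int n * e' + c'" using b by auto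
    have "a + c \<in> {0..int n - 1}" "a' + c' \<in> {0..int n - 1}"
      using direct_sum_mem[OF AC] ec ec' A by blast+
    \<comment> \<open>\<open>e\<close> and \<open>a + c\<close> are the quotient and the remainder
      of \<open>a + b\<close> by \<open>n\<close>.\<close>
    then have "e = e'" using qr[of "a + c" e] qr[of "a' + c'" e'] eq ec ec' by (simp add: algebra_simps)
    then show ?thesis using direct_sum_unique[OF AC A(1) ec(2) A(2) ec'(2)] eq ec ec' by auto
  qed
qed

lemma attractor_if_direct_sum_refine:
  fixes A B :: "int set"
  assumes "finite A" "A \<noteq> {}" and n: "n \<ge> 2" and AB: "direct_sum A B (refine (int n) A)"
  shows "is_attractor B (affine_ifs n) (plus_unit_interval A)"
proof -
  have n0: "n > 0" using n by simp
  obtain a where "a \<in> A" using assms(2) by blast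
  then have "real_of_int a \<in> plus_unit_interval A" unfolding mem_plus_unit_interval by (intro bexI[of _ a]) auto
  then have "plus_unit_interval A \<noteq> {}" by blast
  then have inv: "invariant_compact B (affine_ifs n) (plus_unit_interval A)"
    using compact_plus_unit_interval[OF assms(1)] invariant_if_direct_sum[OF n0 AB]
    by (simp add: invariant_compact_def)
  then show ?thesis using invariant_compact_subset[OF n] unfolding is_attractor_def by blast
qed

lemma attractor_if_tileable:
  fixes A C :: "int set"
  assumes "finite A" "0 \<in> A" "finite C" "n > 0" and AC: "direct_sum A C {0..int n - 1}"
  shows "\<exists>(n::nat) (B::int set). n \<ge> 2 \<and> finite B \<and>
              is_attractor B (affine_ifs n) (plus_unit_interval A) \<and>
              no_overlap B (affine_ifs n) (plus_unit_interval A)"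
proof -
  have "\<exists>(n::nat) B. n \<ge> 2 \<and> finite B \<and> direct_sum A B (refine (int n) A)"
  proof (cases "n = 1")
    case False
    then show ?thesis using direct_sum_refine_if_interval[OF assms(4) AC] assms
      by (intro exI[of _ n] exI[of _ "(\<lambda>(a, c). int n * a + c) ` (A \<times> C)"]) auto
  next
    \<comment> \<open>The ratio 1 is no contraction. Here \<open>A = {0}\<close>, and
      \<open>[0, 1]\<close> is cut into two halves instead.\<close>
    case True
    then have "direct_sum A C {0}" using AC by simp
    then have "a + c = 0" if "a \<in> A" "c \<in> C" for a c using direct_sum_mem that by blast
    moreover obtain c where "c \<in> C" using \<open>direct_sum A C {0}\<close> by (auto elim: direct_sumE)
    ultimately have "\<forall>a\<in>A. a + c = 0 + c" using assms(2) by metis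
    then have "A = {0}" using assms(2) by auto
    moreover have "x \<in> {0, 1}" if "x div 2 = 0" for x :: int using that by auto
    then have "direct_sum {0} {0, 1} (refine 2 {0})" by (auto simp: direct_sum_iff refine_def)
    ultimately show ?thesis by (intro exI[of _ 2] exI[of _ "{0, 1}"]) auto
  qed
  then obtain n B where B: "n \<ge> 2" "finite B" "direct_sum A B (refine (int n) A)" by blast
  then show ?thesis
    using attractor_if_direct_sum_refine[of A n B] no_overlap_if_direct_sum[of n A B] assms
    by (intro exI[of _ n] exI[of _ B]) auto
qed

text \<open>Off the integers \<open>x\<close> determines its translate: the quotient of its floor by
  \<open>n\<close> gives the period, and the remainder splits uniquely as
  \<open>a + c\<close>.\<close>

lemma tiles_by_if_tileable:
  fixes A C :: "int set"
  assumes fin: "finite A" and n: "n > 0" and AC: "direct_sum A C {0..int n - 1}"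
  shows "tiles_by (plus_unit_interval A) (real_of_int ` C + range (\<lambda>k::int. real n * real_of_int k))"
proof -
  let ?T = "real_of_int ` C + range (\<lambda>k::int. real n * real_of_int k)"
  have T: "t \<in> ?T \<longleftrightarrow> (\<exists>c\<in>C. \<exists>k. t = real_of_int (c + int n * k))" for t
    by (auto simp: set_plus_def)
  have shift: "x \<in> (\<lambda>x. x + real_of_int t) ` plus_unit_interval A \<longleftrightarrow> \<lfloor>x\<rfloor> - t \<in> A" if "x \<notin> \<int>" for x t
  proof -
    have "x - real_of_int t \<notin> \<int>" using that by (metis Ints_add Ints_of_int diff_add_cancel)
    moreover have "x \<in> (\<lambda>x. x + real_of_int t) ` plus_unit_interval A \<longleftrightarrow> x - real_of_int t \<in> plus_unit_interval A"
      by force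
    ultimately show ?thesis by (simp add: mem_plus_unit_interval_floor)
  qed
  have Z: "N \<in> null_sets lebesgue" if "N \<subseteq> \<int>" for N :: "real set"
    using that countable_subset null_sets_lebesgue_countable countable_int by (metis Ints_def countableI_type countable_image)
  show ?thesis
    unfolding tiles_by_def
  proof (intro conjI ballI impI)
    show "plus_unit_interval A \<in> sets lebesgue"
      using compact_plus_unit_interval[OF fin] by (simp add: lmeasurable_compact fmeasurableD)
    show "UNIV - (\<Union>t\<in>?T. (\<lambda>x. x + t) ` plus_unit_interval A) \<in> null_sets lebesgue"
    proof (rule Z, rule subsetI, rule ccontr)
      fix x :: real
      assume x: "x \<in> UNIV - (\<Union>t\<in>?T. (\<lambda>x. x + t) ` plus_unit_interval A)" "x \<notin> \<int>"
      have "\<lfloor>x\<rfloor> mod int n \<in> {0..int n - 1}" using n by auto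
      then obtain a c where ac: "a \<in> A" "c \<in> C" "\<lfloor>x\<rfloor> mod int n = a + c" by (rule direct_sumE[OF AC])
      let ?t = "c + int n * (\<lfloor>x\<rfloor> div int n)"
      have "\<lfloor>x\<rfloor> - ?t = a" using ac mult_div_mod_eq[of "int n" "\<lfloor>x\<rfloor>"] by linarith
      then have "x \<in> (\<lambda>x. x + real_of_int ?t) ` plus_unit_interval A"
        using shift[OF x(2), of ?t] ac(1) by simp
      moreover have "real_of_int ?t \<in> ?T" using ac T by blast
      ultimately show False using x by blast
    qed
    fix t t' assume t: "t \<in> ?T" "t' \<in> ?T" "t \<noteq> t'"
    obtain c k where ck: "c \<in> C" "t = real_of_int (c + int n * k)" using t T by blast
    obtain c' k' where ck': "c' \<in> C" "t' = real_of_int (c' + int n * k')" using t T by blast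
    show "(\<lambda>x. x + t) ` plus_unit_interval A \<inter> (\<lambda>x. x + t') ` plus_unit_interval A \<in> null_sets lebesgue"
    proof (rule Z, rule subsetI, rule ccontr)
      fix x assume x: "x \<in> (\<lambda>x. x + t) ` plus_unit_interval A \<inter> (\<lambda>x. x + t') ` plus_unit_interval A"
        and nx: "x \<notin> \<int>"
      let ?a = "\<lfloor>x\<rfloor> - (c + int n * k)" and ?a' = "\<lfloor>x\<rfloor> - (c' + int n * k')"
      have a: "?a \<in> A" "?a' \<in> A" using shift[OF nx] x ck ck' by blast+
      have r: "?a + c \<in> {0..int n - 1}" "?a' + c' \<in> {0..int n - 1}"
        using direct_sum_mem[OF AC] a ck ck' by blast+
      have "\<lfloor>x\<rfloor> div int n = k" using r by (intro int_div_pos_eq[of _ _ _ "?a + c"]) auto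
      moreover have "\<lfloor>x\<rfloor> div int n = k'" using r by (intro int_div_pos_eq[of _ _ _ "?a' + c'"]) auto
      ultimately have "k = k'" by simp
      then have "?a + c = ?a' + c'" by simp
      then have "c = c'" using direct_sum_unique(2)[OF AC a(1) ck(1) a(2) ck'(1)] by blast
      then show False using \<open>k = k'\<close> t ck ck' by simp
    qed
  qed
qed

section \<open>Discrete spectra of direct factors of an interval\<close>

lemma exponential_eq_cis: "exponential l x = cis (2 * pi * l * x)"
  by (simp add: exponential_def cis_conv_exp mult_ac)

lemma exponential_commute: "exponential l x = exponential x l"
  by (simp add: exponential_eq_cis mult_ac)

lemma exponential_0 [simp]: "exponential 0 x = 1" "exponential l 0 = 1"
  by (simp_all add: exponential_eq_cis)

lemma exponential_add: "exponential (l + l') x = exponential l x * exponential l' x"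
  by (simp add: exponential_eq_cis cis_mult algebra_simps)

lemma exponential_add_right: "exponential l (x + y) = exponential l x * exponential l y"
  by (simp add: exponential_eq_cis cis_mult algebra_simps)

lemma exponential_minus: "exponential (- l) x = cnj (exponential l x)"
  by (simp add: exponential_eq_cis cis_cnj)

lemma exponential_diff: "exponential (l - l') x = exponential l x * cnj (exponential l' x)"
  using exponential_add[of l "- l'"] by (simp add: exponential_minus)

lemma norm_exponential [simp]: "norm (exponential l x) = 1"
  by (simp add: exponential_eq_cis)

lemma exponential_eq_1_iff: "exponential l x = 1 \<longleftrightarrow> l * x \<in> \<int>"
proof -
  have "exponential l x = 1 \<longleftrightarrow> (\<exists>k::int. 2 * pi * l * x = of_int (2 * k) * pi)"
    unfolding exponential_eq_cis cis_conv_exp exp_eq_1 by (auto simp: mult_ac)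
  also have "\<dots> \<longleftrightarrow> (\<exists>k::int. l * x = of_int k)" by (auto simp: mult_ac)
  finally show ?thesis by (auto simp: Ints_def)
qed

lemma exponential_of_int_of_int [simp]: "exponential (of_int k) (of_int l) = 1"
  by (metis exponential_eq_1_iff Ints_mult Ints_of_int)

lemma exponential_mult_left: "exponential (k * l) x = exponential l (k * x)"
  by (simp add: exponential_eq_cis mult_ac)

lemma exponential_divide_mult: "m \<noteq> 0 \<Longrightarrow> exponential (l / m) (m * x) = exponential l x"
  by (simp add: exponential_eq_cis mult.assoc)

text \<open>\<open>A\<close> is the point set and \<open>G\<close> the frequency set; as
  \<open>exponential\<close> is symmetric in its arguments, exchanging them passes from the rows to
  the columns of the exponential matrix.\<close>

definition exp_orthogonal :: "real set \<Rightarrow> real set \<Rightarrow> bool" where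
  "exp_orthogonal A G \<longleftrightarrow> (\<forall>g\<in>G. \<forall>g'\<in>G. g \<noteq> g' \<longrightarrow> (\<Sum>a\<in>A. exponential (g - g') a) = 0)"

lemma exp_orthogonalD:
  "exp_orthogonal A G \<Longrightarrow> g \<in> G \<Longrightarrow> g' \<in> G \<Longrightarrow> g \<noteq> g' \<Longrightarrow> (\<Sum>a\<in>A. exponential (g - g') a) = 0"
  by (simp add: exp_orthogonal_def)

text \<open>The exponential matrix of \<open>A\<close> and \<open>G\<close> has orthogonal rows and orthogonal columns. Carrying both
  conditions along avoids inverting the matrix and comparing the sizes of \<open>A\<close> and \<open>G\<close>.\<close>

definition discrete_spectrum :: "real set \<Rightarrow> real set \<Rightarrow> bool" where
  "discrete_spectrum A G \<longleftrightarrow> finite G \<and> G \<noteq> {} \<and> exp_orthogonal A G \<and> exp_orthogonal G A"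

text \<open>All products \<open>g * a\<close> are unchanged.\<close>

lemma exp_orthogonal_scale:
  assumes "m \<noteq> 0" "exp_orthogonal A G"
  shows "exp_orthogonal ((*) m ` A) ((\<lambda>g. g / m) ` G)"
  unfolding exp_orthogonal_def
proof safe
  fix g g' assume g: "g \<in> G" "g' \<in> G" "g / m \<noteq> g' / m"
  have "(\<Sum>a\<in>(*) m ` A. exponential (g / m - g' / m) a) = (\<Sum>a\<in>A. exponential (g / m - g' / m) (m * a))"
    using assms(1) by (intro sum.reindex_cong[of "(*) m"]) (auto simp: inj_on_def)
  also have "\<dots> = (\<Sum>a\<in>A. exponential (g - g') a)"
    using assms(1) by (simp add: exponential_divide_mult flip: diff_divide_distrib)
  finally show "(\<Sum>a\<in>(*) m ` A. exponential (g / m - g' / m) a) = 0"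
    using exp_orthogonalD[OF assms(2)] g by auto
qed

text \<open>A geometric sum with ratio \<open>exponential t 1\<close>, which differs from 1 and has
  \<open>m\<close>-th power 1.\<close>

lemma sum_exponential_multiples:
  assumes "t \<notin> \<int>" "real m * t \<in> \<int>"
  shows "(\<Sum>j<m. exponential t (real j)) = 0"
proof -
  have p: "exponential t (real j) = exponential t 1 ^ j" for j
    unfolding exponential_eq_cis Complex.DeMoivre by (simp add: mult_ac)
  have 1: "exponential t 1 \<noteq> 1" using assms(1) by (simp add: exponential_eq_1_iff)
  have "exponential t 1 ^ m = 1" using assms(2) p[of m] by (metis exponential_eq_1_iff mult.commute)
  then show ?thesis using geometric_sum[OF 1, of m] by (simp add: p)
qed

lemma discrete_spectrum_scale:
  assumes "m > 0" "discrete_spectrum A G"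
  shows "discrete_spectrum ((*) m ` A) ((\<lambda>g. g / m) ` G)"
proof -
  \<comment> \<open>The columns are rescaled by the same lemma, with \<open>G\<close> as the point
    set and the factor \<open>1 / m\<close>.\<close>
  have "exp_orthogonal ((*) (1 / m) ` G) ((\<lambda>a. a / (1 / m)) ` A)"
    using assms by (intro exp_orthogonal_scale) (auto simp: discrete_spectrum_def)
  then show ?thesis
    using assms exp_orthogonal_scale[of m A G] by (simp add: discrete_spectrum_def mult.commute)
qed

text \<open>Uniqueness of quotient and remainder, for real numbers that are integers.\<close>

lemma fractional_part_unique:
  assumes "m > 0" "i < m" "j < m" "x \<in> \<int>" "y \<in> \<int>" "real i + real m * x = real j + real m * y"
  shows "i = j" "x = y"
proof -
  obtain p q where pq: "x = of_int p" "y = of_int q" using assms(4,5) by (metis Ints_cases)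
  then have "real_of_int (int i + int m * p) = real_of_int (int j + int m * q)" using assms(6) by simp
  then have eq: "int i + int m * p = int j + int m * q" by (simp only: of_int_eq_iff)
  have "(int i + int m * p) mod int m = int i" "(int j + int m * q) mod int m = int j" using assms by simp_all
  then show "i = j" using eq by simp
  then show "x = y" using eq pq assms(1) by simp
qed

text \<open>If \<open>A\<close> consists of integers, the exponentials of frequency \<open>(g + j) / m\<close> factor on
  \<open>i + m a\<close>, because \<open>j a\<close> is an integer.\<close>

lemma discrete_spectrum_blocks:
  assumes m: "m > 0" and A: "A \<subseteq> \<int>" "A \<noteq> {}" "finite A" and spec: "discrete_spectrum A G"
  shows "discrete_spectrum ((\<lambda>(i, a). real i + real m * a) ` ({..<m} \<times> A))
           ((\<lambda>(j, g). (real j + g) / real m) ` ({..<m} \<times> G))"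
    (is "discrete_spectrum ?A ?G")
proof -
  have oA: "exp_orthogonal A G" and oG: "exp_orthogonal G A" and G: "finite G" "G \<noteq> {}"
    using spec by (auto simp: discrete_spectrum_def)
  \<comment> \<open>Frequencies in \<open>G\<close> are distinct modulo 1: an integer difference
    would make every term of the orthogonality sum over the integers in \<open>A\<close> equal to
    1.\<close>
  have inZ: "g = g'" if "g \<in> G" "g' \<in> G" "g - g' \<in> \<int>" for g g'
  proof (rule ccontr)
    assume "g \<noteq> g'"
    then have "(\<Sum>a\<in>A. exponential (g - g') a) = 0" using exp_orthogonalD[OF oA] that by blast
    moreover have "exponential (g - g') a = 1" if "a \<in> A" for a
      using A(1) \<open>g - g' \<in> \<int>\<close> that by (auto simp: exponential_eq_1_iff)
    ultimately show False using A by simp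
  qed
  have injA: "inj_on (\<lambda>(i, a). real i + real m * a) ({..<m} \<times> A)"
  proof (rule inj_onI)
    fix p p' assume p: "p \<in> {..<m} \<times> A" "p' \<in> {..<m} \<times> A"
      and eq: "(case p of (i, a) \<Rightarrow> real i + real m * a) = (case p' of (i, a) \<Rightarrow> real i + real m * a)"
    have "fst p < m" "fst p' < m" "snd p \<in> \<int>" "snd p' \<in> \<int>" using p A(1) by auto
    from fractional_part_unique[OF m this] eq show "p = p'" by (simp add: case_prod_beta prod_eq_iff)
  qed
  have injG: "inj_on (\<lambda>(j, g). (real j + g) / real m) ({..<m} \<times> G)"
  proof (rule inj_onI)
    fix p p' assume p: "p \<in> {..<m} \<times> G" "p' \<in> {..<m} \<times> G"
      and eq: "(case p of (j, g) \<Rightarrow> (real j + g) / real m) = (case p' of (j, g) \<Rightarrow> (real j + g) / real m)"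
    obtain j g j' g' where p_eq: "p = (j, g)" "p' = (j', g')" by (cases p, cases p')
    have "real j + g = real j' + g'" using eq m by (simp add: p_eq)
    then have "g - g' = of_int (int j' - int j)" by simp
    then have "g = g'" using inZ[of g g'] p by (simp add: p_eq)
    then show "p = p'" using \<open>real j + g = _\<close> by (simp add: p_eq)
  qed
  have factor: "exponential ((real j + g) / real m) (real i + real m * a) =
      exponential ((real j + g) / real m) (real i) * exponential g a" if "a \<in> \<int>" for j g i a
  proof -
    have "exponential ((real j + g) / real m) (real m * a) = exponential (real j + g) a"
      using m by (simp add: exponential_divide_mult)
    also have "\<dots> = exponential g a"
      using that exponential_eq_1_iff[of "real j" a] by (simp add: exponential_add)
    finally show ?thesis by (simp add: exponential_add_right)
  qed
  have "exp_orthogonal ?A ?G"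
    unfolding exp_orthogonal_def
  proof (intro ballI impI)
    fix s s' assume s: "s \<in> ?G" "s' \<in> ?G" "s \<noteq> s'"
    obtain j g where jg: "j < m" "g \<in> G" "s = (real j + g) / real m" using s(1) by auto
    obtain j' g' where jg': "j' < m" "g' \<in> G" "s' = (real j' + g') / real m" using s(2) by auto
    have factor': "exponential (s - s') (real i + real m * a) = exponential (s - s') (real i) * exponential (g - g') a"
      if "a \<in> A" for i a
      using factor[of a j g i] factor[of a j' g' i] A(1) that jg jg'
      unfolding exponential_diff by (simp add: subset_iff)
    have "(\<Sum>x\<in>?A. exponential (s - s') x) = (\<Sum>(i, a)\<in>{..<m} \<times> A. exponential (s - s') (real i + real m * a))"
      by (subst sum.reindex[OF injA]) (simp add: case_prod_beta comp_def)
    also have "\<dots> = (\<Sum>i<m. \<Sum>a\<in>A. exponential (s - s') (real i) * exponential (g - g') a)"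
      unfolding sum.cartesian_product[symmetric] by (intro sum.cong refl factor')
    also have "\<dots> = (\<Sum>i<m. exponential (s - s') (real i)) * (\<Sum>a\<in>A. exponential (g - g') a)"
      by (simp add: sum_product)
    also have "\<dots> = 0"
    \<comment> \<open>If \<open>g = g'\<close>, then \<open>s - s'\<close> is a proper fraction with
      denominator \<open>m\<close> and the sum over \<open>i\<close> vanishes; otherwise the sum
      over \<open>A\<close> does.\<close>
    proof (cases "g = g'")
      case True
      then have ss: "s - s' = (real j - real j') / real m" using jg jg' by (simp add: diff_divide_distrib[symmetric])
      have "s - s' \<notin> \<int>"
      proof
        assume Z: "s - s' \<in> \<int>"
        \<comment> \<open>If \<open>s - s'\<close> were an integer, \<open>j\<close> and
          \<open>j'\<close> would be congruent modulo \<open>m\<close>; uniqueness of the quotient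
          then gives \<open>s = s'\<close>.\<close>
        have "real j + real m * 0 = real j' + real m * (s - s')" using ss m by simp
        from fractional_part_unique(2)[OF m jg(1) jg'(1) Ints_0 Z this]
        show False using s(3) by simp
      qed
      moreover have "real m * (s - s') \<in> \<int>" using ss m by simp
      ultimately show ?thesis by (simp add: sum_exponential_multiples)
    next
      case False
      then show ?thesis using exp_orthogonalD[OF oA jg(2) jg'(2)] by simp
    qed
    finally show "(\<Sum>x\<in>?A. exponential (s - s') x) = 0" .
  qed
  moreover have "exp_orthogonal ?G ?A"
    unfolding exp_orthogonal_def
  proof (intro ballI impI)
    fix x x' assume x: "x \<in> ?A" "x' \<in> ?A" "x \<noteq> x'"
    obtain i a where ia: "i < m" "a \<in> A" "x = real i + real m * a" using x(1) by auto
    obtain i' a' where ia': "i' < m" "a' \<in> A" "x' = real i' + real m * a'" using x(2) by auto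
    define t where "t = (real i - real i') / real m"
    \<comment> \<open>Dually, \<open>a - a'\<close> is an integer and thus invisible at the integers
      \<open>j\<close>: the sum over \<open>j\<close> depends on \<open>t\<close> alone.\<close>
    have factor': "exponential (x - x') ((real j + g) / real m) = exponential t (real j) * (exponential t g * exponential (a - a') g)"
      if "g \<in> G" for j g
    proof -
      have "a - a' \<in> \<int>" using ia(2) ia'(2) A(1) by (blast intro: Ints_diff)
      moreover have "real m * t = real i - real i'" using m by (simp add: t_def)
      then have "x - x' = real m * t + real m * (a - a')" by (simp add: ia ia' algebra_simps)
      ultimately show ?thesis using m exponential_eq_1_iff[of "a - a'" "real j"]
        by (simp add: exponential_add exponential_mult_left exponential_add_right)
    qed
    have "(\<Sum>s\<in>?G. exponential (x - x') s) = (\<Sum>(j, g)\<in>{..<m} \<times> G. exponential (x - x') ((real j + g) / real m))"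
      by (subst sum.reindex[OF injG]) (simp add: case_prod_beta comp_def)
    also have "\<dots> = (\<Sum>j<m. \<Sum>g\<in>G. exponential t (real j) * (exponential t g * exponential (a - a') g))"
      unfolding sum.cartesian_product[symmetric] by (intro sum.cong refl factor')
    also have "\<dots> = (\<Sum>j<m. exponential t (real j)) * (\<Sum>g\<in>G. exponential t g * exponential (a - a') g)"
      by (simp add: sum_product)
    also have "\<dots> = 0"
    \<comment> \<open>For \<open>i = i'\<close> one has \<open>t = 0\<close>, and the columns of the
      given matrix are orthogonal; otherwise \<open>t\<close> is not an integer while
      \<open>m * t\<close> is, and the sum over \<open>j\<close> vanishes.\<close>
    proof (cases "i = i'")
      case True
      then show ?thesis using exp_orthogonalD[OF oG ia(2) ia'(2)] x(3) ia ia' by (auto simp: t_def)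
    next
      case False
      have "t \<notin> \<int>"
      proof
        assume Z: "t \<in> \<int>"
        have "real i + real m * 0 = real i' + real m * t" using m by (simp add: t_def)
        from fractional_part_unique(1)[OF m ia(1) ia'(1) Ints_0 Z this]
        show False using False by simp
      qed
      moreover have "real m * t \<in> \<int>" using m by (simp add: t_def)
      ultimately show ?thesis by (simp add: sum_exponential_multiples)
    qed
    finally show "(\<Sum>s\<in>?G. exponential (x - x') s) = 0" .
  qed
  ultimately show ?thesis using G m by (simp add: discrete_spectrum_def lessThan_empty_iff)
qed

text \<open>Translating the points multiplies each sum by a constant.\<close>

lemma exp_orthogonal_translate:
  assumes "exp_orthogonal A G"
  shows "exp_orthogonal ((\<lambda>x. x + t) ` A) G"
  unfolding exp_orthogonal_def
proof (intro ballI impI)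
  fix g g' assume g: "g \<in> G" "g' \<in> G" "g \<noteq> g'"
  have "(\<Sum>a\<in>(\<lambda>x. x + t) ` A. exponential (g - g') a) = (\<Sum>a\<in>A. exponential (g - g') a * exponential (g - g') t)"
    by (subst sum.reindex) (auto simp: inj_on_def exponential_add_right)
  also have "\<dots> = 0" using exp_orthogonalD[OF assms g] by (simp flip: sum_distrib_right)
  finally show "(\<Sum>a\<in>(\<lambda>x. x + t) ` A. exponential (g - g') a) = 0" .
qed

text \<open>The column condition involves only differences of points, which a translation
  preserves.\<close>

lemma discrete_spectrum_translate:
  "discrete_spectrum A G \<Longrightarrow> discrete_spectrum ((\<lambda>x. x + t) ` A) G"
  using exp_orthogonal_translate[of A G t]
  by (auto simp: discrete_spectrum_def exp_orthogonal_def)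

section \<open>Factorizations of an interval of natural numbers\<close>

lemma direct_sum_commute:
  fixes A :: "'a::ab_semigroup_add set"
  shows "direct_sum A C D \<Longrightarrow> direct_sum C A D"
  unfolding direct_sum_iff by (auto simp: add.commute) (metis add.commute)+

text \<open>The structure theorem of de Bruijn for factorizations of an interval, one block of length
  \<open>m\<close> at a time.\<close>

lemma interval_factorization_blocks:
  fixes A C :: "nat set"
  assumes n: "n > 0" and AC: "direct_sum A C {..<n}"
    and m: "m \<in> C" "m > 0" and min: "\<And>c. c \<in> C \<Longrightarrow> c > 0 \<Longrightarrow> m \<le> c"
  shows "\<forall>x. x div m = k \<longrightarrow> (x \<in> A \<longleftrightarrow> m * k \<in> A) \<and> (x \<in> C \<longrightarrow> x = m * k)"
proof -
  note uniq = direct_sum_unique[OF AC] and mem = direct_sum_mem[OF AC] and rep = direct_sumE[OF AC]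
  obtain a0 c0 where "a0 \<in> A" "c0 \<in> C" "0 = a0 + c0" using rep[of 0] n by blast
  then have 0: "0 \<in> A" "0 \<in> C" by simp_all
  have Cm: "c = 0" if "c \<in> C" "c < m" for c using min[OF that(1)] that(2) by (cases "c = 0") auto
  \<comment> \<open>Below \<open>m\<close> the only possible summand from \<open>C\<close> is 0, so
    the first block lies in \<open>A\<close>.\<close>
  have Am: "r \<in> A" if r: "r < m" for r
  proof -
    have "r < n" using mem[OF 0(1) m(1)] r by simp
    then obtain a c where ac: "a \<in> A" "c \<in> C" "r = a + c" using rep[of r] by blast
    then have "c = 0" using Cm[of c] r by simp
    then show ?thesis using ac by simp
  qed
  have block: "x div m = q \<longleftrightarrow> (\<exists>r<m. x = m * q + r)" for x q
    using m(2) by (auto intro!: exI[of _ "x mod m"])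
  show ?thesis
  \<comment> \<open>Strong induction over the blocks of length \<open>m\<close>. A block with
    \<open>k > 0\<close> is either reached by a sum of two elements below it, or decided by its
    first point \<open>?K\<close>.\<close>
  proof (induction k rule: less_induct)
    case (less k)
    have IHA: "m * q + r \<in> A \<longleftrightarrow> m * q \<in> A" if "q < k" "r < m" for q r
      using less that block by blast
    have IHC: "r = 0" if "q < k" "r < m" "m * q + r \<in> C" for q r
      using less that block by (metis add_cancel_right_right)
    have "(m * k + r \<in> A \<longleftrightarrow> m * k \<in> A) \<and> (m * k + r \<in> C \<longrightarrow> r = 0)" if r: "r < m" for r
    proof (cases "k = 0")
      case True
      then show ?thesis using Am 0 r Cm by auto
    next
      case k: False
      let ?K = "m * k"
      have K: "m \<le> ?K" using k by simp
      show ?thesis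
      proof (cases "\<exists>a\<in>A. \<exists>c\<in>C. a < ?K \<and> c < ?K \<and> ?K \<le> a + c \<and> a + c < ?K + m")
        \<comment> \<open>By induction \<open>c\<close> is a multiple of \<open>m\<close> and the
          block of \<open>a\<close> lies in \<open>A\<close>, so block \<open>k\<close> is that
          block shifted by \<open>c\<close>. Its points are thus sums using \<open>c\<close>, with
          \<open>0 < c < ?K\<close>, and uniqueness bars them from \<open>A\<close> and
          \<open>C\<close>.\<close>
        case True
        then obtain a c where ac: "a \<in> A" "c \<in> C" "a < ?K" "c < ?K" "?K \<le> a + c" "a + c < ?K + m"
          by blast
        define q where "q = a div m"
        define q' where "q' = c div m"
        have qq: "q < k" "q' < k" using ac m(2) by (simp_all add: q_def q'_def less_mult_imp_div_less mult.commute)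
        have cq: "c = m * q'" using IHC[OF qq(2), of "c mod m"] ac(2) m(2) mult_div_mod_eq[of m c] by (simp add: q'_def)
        have a_eq: "a = m * q + a mod m" by (simp add: q_def)
        have "m * q \<in> A" using IHA[OF qq(1), of "a mod m"] ac(1) m(2) a_eq by simp
        have "(a + c) div m = k" using ac m(2) by (intro div_nat_eqI) (simp_all add: mult.commute)
        moreover have "(a + c) div m = q + q'" using m(2) by (simp add: cq q_def)
        ultimately have Kq: "?K = m * q + c" by (simp add: cq distrib_left flip: \<open>(a + c) div m = k\<close>)
        have c0: "c \<noteq> 0" using ac by auto
        have notin: "?K + r \<notin> A \<and> ?K + r \<notin> C" if "r < m" for r
        proof -
          have "m * q + r \<in> A" using IHA[OF qq(1) that] \<open>m * q \<in> A\<close> by simp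
          moreover have "?K + r = (m * q + r) + c" using Kq by simp
          ultimately show ?thesis
            using uniq(2)[of "?K + r" 0 "m * q + r" c] uniq(2)[of 0 "?K + r" "m * q + r" c] 0 ac(2,4) c0
            by auto
        qed
        show ?thesis using notin[OF r] notin[OF m(2)] by simp
      next
        case False
        then have rep': "?K \<le> a \<or> ?K \<le> c" if "a \<in> A" "c \<in> C" "?K \<le> a + c" "a + c < ?K + m" for a c
          using that by (meson not_le)
        consider "?K \<in> C" | "?K \<in> A" | "?K \<notin> A" "?K \<notin> C" by blast
        then show ?thesis
        proof cases
          \<comment> \<open>\<open>?K + r\<close> already has the representation
            \<open>r + ?K\<close> with \<open>r \<in> A\<close>.\<close>
          case 1
          have notin: "?K + r \<notin> A" if "r < m" for r
            using uniq(2)[of "?K + r" 0 r ?K] Am[OF that] 0 1 k m(2) by auto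
          have "r = 0" if "?K + r \<in> C" using uniq(1)[of 0 "?K + r" r ?K] Am[OF r] 0 1 that by simp
          then show ?thesis using notin[OF r] notin[OF m(2)] by auto
        next
          case 2
          have inA: "?K + r \<in> A" if "r < m" for r using that
          proof (induction r rule: less_induct)
            case (less r)
            show ?case
            proof (rule ccontr)
              assume nA: "?K + r \<notin> A"
              have r0: "r > 0" using nA 2 by (cases r) auto
              have "?K + r < n" using mem[OF 2 m(1)] less.prems by simp
              then obtain a c where ac: "a \<in> A" "c \<in> C" "?K + r = a + c" using rep[of "?K + r"] by blast
              show False
              proof (cases "?K \<le> a")
                case True
                then have "c = 0" using Cm[of c] ac less.prems by simp
                then show False using ac nA by simp
              next
                case False
                then have Kc: "?K \<le> c" using rep'[of a c] ac less.prems by simp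
                define i where "i = c - ?K"
                have ci: "c = ?K + i" "i \<le> r" using Kc ac by (auto simp: i_def)
                show False
                proof (cases "i = r")
                  case True
                  \<comment> \<open>Now \<open>c = ?K + r\<close>, and \<open>?K + m\<close> is
                    represented both as \<open>(m - r) + c\<close> and with the summands
                    \<open>?K\<close> and \<open>m\<close>.\<close>
                  have "m - r \<in> A" using Am r0 m(2) by simp
                  moreover have "(m - r) + c = ?K + m" using ci True less.prems by simp
                  ultimately have "c = m" using uniq(2)[of "m - r" c ?K m] ac 2 m(1) by blast
                  then show False using ci True K r0 by simp
                next
                  case False
                  \<comment> \<open>By the inner induction \<open>c\<close> lies in both sets, and 0
                    is their only common element.\<close>
                  then have "c \<in> A" using less.IH[of i] ci less.prems by simp
                  then have "c = 0" using uniq(1)[of c 0 0 c] 0 ac(2) by simp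
                  then show False using ci k m(2) by simp
                qed
              qed
            qed
          qed
          have "?K + r \<notin> C"
          proof
            assume "?K + r \<in> C"
            then have "?K + r = 0" using uniq(1)[of "?K + r" 0 0 "?K + r"] inA[OF r] 0 by simp
            then show False using k m(2) by simp
          qed
          then show ?thesis using inA[OF r] 2 by simp
        next
          case 3
          \<comment> \<open>A representation of \<open>?K\<close> would need a summand equal to
            \<open>?K\<close>, so the interval has ended before this block.\<close>
          have "n \<le> ?K"
          proof (rule ccontr)
            assume "\<not> n \<le> ?K"
            then obtain a c where ac: "a \<in> A" "c \<in> C" "?K = a + c" using rep[of ?K] by auto
            then consider "?K \<le> a" | "?K \<le> c" using rep'[of a c] m(2) by auto
            then show False
            proof cases
              case 1 then show False using ac 3 by (metis add_leD1 le_add1 le_antisym)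
            next
              case 2 then show False using ac 3 by (metis le_add2 le_antisym)
            qed
          qed
          moreover have "x < n" if "x \<in> A \<or> x \<in> C" for x using mem[of x 0] mem[of 0 x] 0 that by auto
          ultimately show ?thesis using 3 by (metis not_le trans_le_add1)
        qed
      qed
    qed
    then show ?case using block by (metis add_cancel_right_right)
  qed
qed

text \<open>The least nonzero element \<open>m\<close> of \<open>C\<close> is the block length, and
  dividing by \<open>m\<close> leaves a factorization of an interval. The assumption
  \<open>1 \<in> A\<close> excludes \<open>m = 1\<close>, hence the new interval is shorter.\<close>

lemma interval_factorization_reduce:
  fixes A C :: "nat set"
  assumes n: "n \<ge> 2" and AC: "direct_sum A C {..<n}" and 1: "1 \<in> A"
  obtains m A' C' n' where "m > 0" "0 < n'" "n' < n" "direct_sum A' C' {..<n'}"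
    "A = (\<lambda>(i, q). i + m * q) ` ({..<m} \<times> A')" "C = (*) m ` C'"
proof (cases "C = {0}")
  \<comment> \<open>Without a nonzero element in \<open>C\<close>, the set \<open>A\<close> is a
    single block of length \<open>n\<close>.\<close>
  case True
  then have "A = {..<n}" using AC by (auto simp: direct_sum_iff)
  then show thesis using True n by (intro that[of n 1 "{0}" "{0}"]) (auto simp: direct_sum_iff image_iff)
next
  case False
  note uniq = direct_sum_unique[OF AC] and mem = direct_sum_mem[OF AC] and rep = direct_sumE[OF AC]
  obtain a0 c0 where "a0 \<in> A" "c0 \<in> C" "0 = a0 + c0" using rep[of 0] n by auto
  then have 0: "0 \<in> A" "0 \<in> C" by simp_all
  then have ex: "\<exists>c. c \<in> C \<and> c > 0" using False by auto
  define m where "m = (LEAST c. c \<in> C \<and> c > 0)"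
  have m: "m \<in> C" "m > 0" using LeastI_ex[OF ex] by (simp_all add: m_def)
  have min: "m \<le> c" if "c \<in> C" "c > 0" for c unfolding m_def using that by (intro Least_le) simp
  \<comment> \<open>Otherwise \<open>1 + 0 = 0 + 1\<close> would be two representations.\<close>
  have "m \<noteq> 1" using uniq(1)[of 1 0 0 1] 1 0 m by auto
  then have m2: "m \<ge> 2" using m by simp
  have blocks: "x \<in> A \<longleftrightarrow> m * (x div m) \<in> A" "x \<in> C \<Longrightarrow> x = m * (x div m)" for x
  proof -
    have "0 < n" using n by simp
    from interval_factorization_blocks[OF this AC m min]
    show "x \<in> A \<longleftrightarrow> m * (x div m) \<in> A" "x \<in> C \<Longrightarrow> x = m * (x div m)" by blast+
  qed
  define A' where "A' = {q. m * q \<in> A}"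
  define C' where "C' = {q. m * q \<in> C}"
  \<comment> \<open>The number of multiples of \<open>m\<close> below \<open>n\<close>, that is
    \<open>n / m\<close> rounded up.\<close>
  define n' where "n' = (n - 1) div m + 1"
  have n': "q < n' \<longleftrightarrow> m * q < n" for q
  proof -
    have "q < n' \<longleftrightarrow> q \<le> (n - 1) div m" by (auto simp: n'_def)
    also have "\<dots> \<longleftrightarrow> q * m \<le> n - 1" using m(2) by (simp add: less_eq_div_iff_mult_less_eq)
    finally show ?thesis using n by (auto simp: mult.commute)
  qed
  have A: "A = (\<lambda>(i, q). i + m * q) ` ({..<m} \<times> A')"
  proof (intro equalityI subsetI)
    fix x assume "x \<in> A"
    then show "x \<in> (\<lambda>(i, q). i + m * q) ` ({..<m} \<times> A')"
      using blocks(1)[of x] m by (intro image_eqI[of _ _ "(x mod m, x div m)"]) (auto simp: A'_def)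
  next
    fix x assume "x \<in> (\<lambda>(i, q). i + m * q) ` ({..<m} \<times> A')"
    then obtain i q where "i < m" "m * q \<in> A" "x = i + m * q" by (auto simp: A'_def)
    then show "x \<in> A" using blocks(1)[of x] by simp
  qed
  have C: "C = (*) m ` C'" using blocks(2) by (auto simp: C'_def intro!: image_eqI)
  have "direct_sum A' C' {..<n'}"
  proof (rule direct_sumI)
    show "a + c \<in> {..<n'}" if "a \<in> A'" "c \<in> C'" for a c
      using mem[of "m * a" "m * c"] that by (simp add: A'_def C'_def n' distrib_left)
    show "\<exists>a\<in>A'. \<exists>c\<in>C'. x = a + c" if "x \<in> {..<n'}" for x
    proof -
      have "m * x \<in> {..<n}" using that n' by simp
      then obtain a c where ac: "a \<in> A" "c \<in> C" "m * x = a + c" by (rule rep)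
      define q where "q = c div m"
      have c: "c = m * q" using blocks(2) ac by (simp add: q_def)
      then have a: "a = m * (x - q)" using ac by (simp add: diff_mult_distrib2)
      have "m * q \<le> m * x" using ac c by simp
      then have "q \<le> x" using m by simp
      then show ?thesis using ac a c
        by (intro bexI[of _ "x - q"] bexI[of _ q]) (simp_all add: A'_def C'_def)
    qed
    show "a = a' \<and> c = c'" if "a \<in> A'" "c \<in> C'" "a' \<in> A'" "c' \<in> C'" "a + c = a' + c'" for a c a' c'
      using uniq[of "m * a" "m * c" "m * a'" "m * c'"] that m
      by (simp add: A'_def C'_def flip: distrib_left)
  qed
  moreover have "(n - 1) div m < n - 1" using m2 n by (intro div_less_dividend) simp_all
  then have "n' < n" by (simp add: n'_def)
  moreover have "0 < n'" by (simp add: n'_def)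
  ultimately show thesis using that[of m n' A' C'] m A C by blast
qed

text \<open>The factor containing 1 consists of blocks, the other of multiples of \<open>m\<close>.
  Either may be \<open>A\<close>, so both constructions of spectra occur, with the induction
  hypothesis applied to \<open>A'\<close> or to \<open>C'\<close>.\<close>

lemma exists_discrete_spectrum_nat:
  fixes A C :: "nat set"
  assumes "n > 0" "direct_sum A C {..<n}"
  shows "\<exists>G. discrete_spectrum (real ` A) G"
  using assms
proof (induction n arbitrary: A C rule: less_induct)
  case (less n)
  have singleton: "\<exists>G. discrete_spectrum (real ` {0}) G"
    by (intro exI[of _ "{0}"]) (simp add: discrete_spectrum_def exp_orthogonal_def)
  have "0 \<in> {..<n}" using less.prems by simp
  then obtain a0 c0 where "a0 \<in> A" "c0 \<in> C" "0 = a0 + c0" by (rule direct_sumE[OF less.prems(2)])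
  then have 0: "0 \<in> A" "0 \<in> C" by simp_all
  have "A \<subseteq> {..<n}" using direct_sum_mem[OF less.prems(2) _ 0(2)] by auto
  then have finA: "finite A" by (rule finite_subset) simp
  show ?case
  proof (cases "n = 1")
    case True
    then have "A = {0}" using \<open>A \<subseteq> {..<n}\<close> 0 by auto
    then show ?thesis using singleton by simp
  next
    case False
    then have n: "n \<ge> 2" using less.prems by simp
    then have "1 \<in> {..<n}" by simp
    then obtain a c where "a \<in> A" "c \<in> C" "1 = a + c" by (rule direct_sumE[OF less.prems(2)])
    then consider "1 \<in> A" | "1 \<in> C" by (cases a) auto
    then show ?thesis
    proof cases
      case 1
      obtain m A' C' n' where m: "m > 0" "0 < n'" "n' < n" "direct_sum A' C' {..<n'}"
        "A = (\<lambda>(i, q). i + m * q) ` ({..<m} \<times> A')"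
        using interval_factorization_reduce[OF n less.prems(2) 1] by metis
      obtain G where "discrete_spectrum (real ` A') G" using less.IH m by blast
      moreover have "A' \<noteq> {}" using m(5) 0 by auto
      moreover have "finite A'"
      proof -
        have "A' \<subseteq> {q. m * q \<in> A}" using m(1,5) by force
        moreover have "finite {q. m * q \<in> A}"
          using finite_vimageI[OF finA, of "(*) m"] m(1) by (simp add: inj_on_def vimage_def)
        ultimately show ?thesis by (rule finite_subset)
      qed
      ultimately have "discrete_spectrum ((\<lambda>(i, a). real i + real m * a) ` ({..<m} \<times> real ` A'))
          ((\<lambda>(j, g). (real j + g) / real m) ` ({..<m} \<times> G))"
        using m by (intro discrete_spectrum_blocks) auto
      moreover have "(\<lambda>(i, a). real i + real m * a) ` ({..<m} \<times> real ` A') = real ` A"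
        unfolding m(5) by force
      ultimately show ?thesis by auto
    next
      case 2
      obtain m A' C' n' where m: "m > 0" "0 < n'" "n' < n" "direct_sum A' C' {..<n'}" "A = (*) m ` C'"
        using interval_factorization_reduce[OF n direct_sum_commute[OF less.prems(2)] 2] by metis
      obtain G where "discrete_spectrum (real ` C') G"
        using less.IH[OF m(3,2) direct_sum_commute[OF m(4)]] by blast
      from discrete_spectrum_scale[OF _ this, of "real m"]
      have "discrete_spectrum ((*) (real m) ` real ` C') ((\<lambda>g. g / real m) ` G)" using m by simp
      moreover have "(*) (real m) ` real ` C' = real ` A" unfolding m(5) by (simp add: image_image)
      ultimately show ?thesis by auto
    qed
  qed
qed

text \<open>Translating both factors so that they start at 0 reduces to natural numbers; a spectrum
  survives the translation back.\<close>

lemma exists_discrete_spectrum: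
  fixes A C :: "int set"
  assumes n: "n > 0" and AC: "direct_sum A C {0..int n - 1}"
  shows "\<exists>G. discrete_spectrum (real_of_int ` A) G"
proof -
  have "0 \<in> {0..int n - 1}" using n by simp
  then obtain a0 c0 where a0: "a0 \<in> A" "c0 \<in> C" "0 = a0 + c0" by (rule direct_sumE[OF AC])
  \<comment> \<open>As \<open>a0 + c0 = 0\<close> is the least of all sums, \<open>a0\<close> and
    \<open>c0\<close> are the minima.\<close>
  have ge: "a0 \<le> a" if "a \<in> A" for a using direct_sum_mem[OF AC that a0(2)] a0 by auto
  have gc: "c0 \<le> c" if "c \<in> C" for c using direct_sum_mem[OF AC a0(1) that] a0 by auto
  let ?A = "(\<lambda>a. nat (a - a0)) ` A" and ?C = "(\<lambda>c. nat (c - c0)) ` C"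
  have add: "int (nat (a - a0) + nat (c - c0)) = a + c" if "a \<in> A" "c \<in> C" for a c
    using ge gc that a0(3) by simp
  have "direct_sum ?A ?C {..<n}"
  proof (rule direct_sumI)
    show "x + y \<in> {..<n}" if xy: "x \<in> ?A" "y \<in> ?C" for x y
    proof -
      obtain a c where ac: "a \<in> A" "c \<in> C" "x = nat (a - a0)" "y = nat (c - c0)" using xy by blast
      have "int (x + y) \<in> {0..int n - 1}"
        using add[OF ac(1,2)] direct_sum_mem[OF AC ac(1,2)] by (simp only: ac(3,4))
      then show ?thesis by simp
    qed
    show "\<exists>x\<in>?A. \<exists>y\<in>?C. d = x + y" if "d \<in> {..<n}" for d
    proof -
      have "int d \<in> {0..int n - 1}" using that by auto
      then obtain a c where ac: "a \<in> A" "c \<in> C" "int d = a + c" by (rule direct_sumE[OF AC])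
      have "int (nat (a - a0) + nat (c - c0)) = int d" using add[OF ac(1,2)] ac(3) by simp
      then have "d = nat (a - a0) + nat (c - c0)" by linarith
      then show ?thesis using ac by blast
    qed
    show "x = x' \<and> y = y'" if xy: "x \<in> ?A" "y \<in> ?C" "x' \<in> ?A" "y' \<in> ?C" "x + y = x' + y'" for x y x' y'
    proof -
      obtain a c where ac: "a \<in> A" "c \<in> C" "x = nat (a - a0)" "y = nat (c - c0)" using xy by blast
      obtain a' c' where ac': "a' \<in> A" "c' \<in> C" "x' = nat (a' - a0)" "y' = nat (c' - c0)" using xy by blast
      have "a + c = a' + c'" using add[OF ac(1,2)] add[OF ac'(1,2)] xy(5) by (simp only: ac(3,4) ac'(3,4))
      then show ?thesis using direct_sum_unique[OF AC ac(1,2) ac'(1,2)] ac ac' by simp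
    qed
  qed
  then obtain G where "discrete_spectrum (real ` ?A) G" using exists_discrete_spectrum_nat[OF n] by blast
  then have "discrete_spectrum ((\<lambda>x. x + real_of_int a0) ` real ` ?A) G" by (rule discrete_spectrum_translate)
  moreover have "(\<lambda>x. x + real_of_int a0) ` real ` ?A = real_of_int ` A"
    unfolding image_image using ge by (intro image_cong refl) simp
  ultimately show ?thesis by auto
qed

section \<open>Density of exponentials\<close>

definition exp_span :: "real set \<Rightarrow> (real \<Rightarrow> complex) \<Rightarrow> bool" where
  "exp_span L p \<longleftrightarrow> (\<exists>F c. finite F \<and> F \<subseteq> L \<and> p = (\<lambda>x. \<Sum>l\<in>F. c l * exponential l x))"

lemma exp_span_monomial: "l \<in> L \<Longrightarrow> exp_span L (\<lambda>x. c * exponential l x)"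
  unfolding exp_span_def by (intro exI[of _ "{l}"] exI[of _ "\<lambda>_. c"]) auto

lemma exp_span_add:
  assumes "exp_span L p" "exp_span L q"
  shows "exp_span L (\<lambda>x. p x + q x)"
proof -
  obtain F c where F: "finite F" "F \<subseteq> L" "p = (\<lambda>x. \<Sum>l\<in>F. c l * exponential l x)"
    using assms(1) by (auto simp: exp_span_def)
  obtain G d where G: "finite G" "G \<subseteq> L" "q = (\<lambda>x. \<Sum>l\<in>G. d l * exponential l x)"
    using assms(2) by (auto simp: exp_span_def)
  have p: "p x = (\<Sum>l\<in>F \<union> G. (if l \<in> F then c l else 0) * exponential l x)" for x
    unfolding F(3) using F(1) G(1) by (intro sum.mono_neutral_cong_left) auto
  have q: "q x = (\<Sum>l\<in>F \<union> G. (if l \<in> G then d l else 0) * exponential l x)" for x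
    unfolding G(3) using F(1) G(1) by (intro sum.mono_neutral_cong_left) auto
  show ?thesis
    unfolding exp_span_def p q sum.distrib[symmetric] distrib_right[symmetric]
    using F G by (intro exI[of _ "F \<union> G"] exI conjI refl) auto
qed

lemma exp_span_zero: "exp_span L (\<lambda>x. 0)"
  unfolding exp_span_def by (intro exI[of _ "{}"]) auto

lemma exp_span_sum:
  assumes "finite I" "\<And>i. i \<in> I \<Longrightarrow> exp_span L (p i)"
  shows "exp_span L (\<lambda>x. \<Sum>i\<in>I. p i x)"
  using assms by (induction I rule: finite_induct) (simp_all add: exp_span_zero exp_span_add)

lemma exp_span_mult:
  assumes "exp_span L p" "exp_span L' q" "\<And>l l'. l \<in> L \<Longrightarrow> l' \<in> L' \<Longrightarrow> l + l' \<in> K"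
  shows "exp_span K (\<lambda>x. p x * q x)"
proof -
  obtain F c where F: "finite F" "F \<subseteq> L" "p = (\<lambda>x. \<Sum>l\<in>F. c l * exponential l x)"
    using assms(1) by (auto simp: exp_span_def)
  obtain G d where G: "finite G" "G \<subseteq> L'" "q = (\<lambda>x. \<Sum>l\<in>G. d l * exponential l x)"
    using assms(2) by (auto simp: exp_span_def)
  have "p x * q x = (\<Sum>l\<in>F. \<Sum>l'\<in>G. (c l * d l') * exponential (l + l') x)" for x
    unfolding F(3) G(3) sum_product by (simp add: exponential_add mult_ac)
  moreover have "exp_span K (\<lambda>x. \<Sum>l\<in>F. \<Sum>l'\<in>G. (c l * d l') * exponential (l + l') x)"
    using F G assms(3) by (intro exp_span_sum exp_span_monomial) auto
  ultimately show ?thesis by simp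
qed

text \<open>Lets one approximant on \<open>[0, 1]\<close> serve all cells of
  \<open>A + [0, 1]\<close>.\<close>

lemma exp_span_Ints_periodic:
  assumes "exp_span \<int> p"
  shows "p (x + real_of_int a) = p x"
proof -
  obtain F c where F: "finite F" "F \<subseteq> \<int>" "p = (\<lambda>x. \<Sum>l\<in>F. c l * exponential l x)"
    using assms by (auto simp: exp_span_def)
  have "exponential l (real_of_int a) = 1" if "l \<in> F" for l
    using F(2) that by (auto simp: exponential_eq_1_iff intro!: Ints_mult)
  then show ?thesis unfolding F(3) exponential_add_right by simp
qed

lemma continuous_on_exponential [continuous_intros]:
  "continuous_on S f \<Longrightarrow> continuous_on S (\<lambda>x. exponential l (f x))"
  unfolding exponential_def by (intro continuous_intros)

lemma continuous_on_exp_span: "exp_span L p \<Longrightarrow> continuous_on S p"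
  unfolding exp_span_def by (auto intro!: continuous_intros)

text \<open>On the unit circle a real-linear form is a combination of \<open>z\<close> and its
  conjugate, that is of the frequencies 1 and -1; products add frequencies, which stay
  integers.\<close>

lemma exp_span_real_polynomial:
  fixes g :: "complex \<Rightarrow> real"
  assumes "real_polynomial_function g"
  shows "exp_span \<int> (\<lambda>x. of_real (g (exponential 1 x)))"
  using assms
proof induction
  case (linear f)
  then interpret bounded_linear f .
  have f: "f z = Re z * f 1 + Im z * f \<i>" for z
  proof -
    have "z = Re z *\<^sub>R 1 + Im z *\<^sub>R \<i>" by (simp add: complex_eq_iff)
    then have "f z = f (Re z *\<^sub>R 1 + Im z *\<^sub>R \<i>)" by simp
    then show ?thesis by (simp only: add scaleR real_scaleR_def)
  qed
  let ?c = "complex_of_real (f 1) / 2 + complex_of_real (f \<i>) / (2 * \<i>)"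
  let ?d = "complex_of_real (f 1) / 2 - complex_of_real (f \<i>) / (2 * \<i>)"
  have "complex_of_real (f (exponential 1 x)) = ?c * exponential 1 x + ?d * exponential (-1) x" for x
    unfolding exponential_minus by (subst f) (simp add: complex_eq_iff field_simps)
  moreover have "exp_span \<int> (\<lambda>x. ?c * exponential 1 x + ?d * exponential (-1) x)"
    by (intro exp_span_add exp_span_monomial) auto
  ultimately show ?case by simp
next
  case (const c)
  show ?case using exp_span_monomial[of 0 \<int> "of_real c"] by simp
next
  case (add f g)
  then show ?case using exp_span_add by simp
next
  case (mult f g)
  then show ?case using exp_span_mult[of \<int> _ \<int> _ \<int>] by simp
qed

text \<open>Equal end values make \<open>h\<close> a continuous function on the circle, to which
  Stone-Weierstrass applies.\<close>

lemma periodic_continuous_uniform_approx: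
  fixes h :: "real \<Rightarrow> complex"
  assumes cont: "continuous_on {0..1} h" and per: "h 0 = h 1" and e: "e > 0"
  shows "\<exists>p. exp_span \<int> p \<and> (\<forall>x\<in>{0..1}. cmod (h x - p x) < e)"
proof -
  let ?H = "h \<circ> (\<lambda>z. Arg2pi z / (2 * pi))"
  \<comment> \<open>The trivial homotopy of the loop \<open>h\<close> serves to transfer its
    continuity to the circle.\<close>
  have "homotopic_loops (h ` {0..1}) h h"
    using cont per by (auto simp: homotopic_loops_refl path_def path_image_def pathstart_def pathfinish_def)
  then have "homotopic_with_canon (\<lambda>h. True) (sphere 0 1) (h ` {0..1}) ?H ?H"
    by (rule homotopic_loops_imp_homotopic_circlemaps)
  then have "continuous_on (sphere 0 1) ?H" using homotopic_with_imp_continuous by blast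
  from Stone_Weierstrass_polynomial_function[OF compact_sphere this e]
  obtain g where g: "polynomial_function g" "\<And>z. z \<in> sphere 0 1 \<Longrightarrow> cmod (?H z - g z) < e"
    by metis
  have H: "?H (exponential 1 x) = h x" if x: "x \<in> {0..1}" for x
  \<comment> \<open>The argument of the circle point is back at 0 for \<open>x = 1\<close>, where
    \<open>h 0 = h 1\<close> steps in.\<close>
  proof (cases "x = 1")
    case True
    then show ?thesis using per exponential_of_int_of_int[of 1 1] Arg2pi_of_real[of 1] by simp
  next
    case False
    have "Arg2pi (exponential 1 x) = 2 * pi * x"
      unfolding exponential_def using x False by (subst Arg2pi_exp) auto
    then show ?thesis by simp
  qed
  have "real_polynomial_function (Re \<circ> g)" "real_polynomial_function (Im \<circ> g)"
    using g(1) bounded_linear_Re bounded_linear_Im by (auto simp: polynomial_function_def)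
  then have "exp_span \<int> (\<lambda>x. of_real (Re (g (exponential 1 x))))" "exp_span \<int> (\<lambda>x. of_real (Im (g (exponential 1 x))))"
    using exp_span_real_polynomial by fastforce+
  \<comment> \<open>The constant \<open>\<i>\<close> is written as a monomial of frequency
    0.\<close>
  then have "exp_span \<int> (\<lambda>x. of_real (Re (g (exponential 1 x))) + \<i> * exponential 0 x * of_real (Im (g (exponential 1 x))))"
    by (intro exp_span_add exp_span_mult[of \<int> _ \<int>] exp_span_monomial) auto
  also have "(\<lambda>x. of_real (Re (g (exponential 1 x))) + \<i> * exponential 0 x * of_real (Im (g (exponential 1 x)))) = (\<lambda>x. g (exponential 1 x))"
    by (simp flip: complex_eq)
  finally have "exp_span \<int> (\<lambda>x. g (exponential 1 x))" .
  moreover have "cmod (h x - g (exponential 1 x)) < e" if "x \<in> {0..1}" for x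
    using g(2)[of "exponential 1 x"] H[OF that] by simp
  ultimately show ?thesis by blast
qed

section \<open>Square-integrable functions\<close>

lemma norm_add_squared_le: "(norm (x + y))\<^sup>2 \<le> 2 * (norm x)\<^sup>2 + 2 * (norm (y::'a::real_normed_vector))\<^sup>2"
proof -
  have "(norm (x + y))\<^sup>2 \<le> (norm x + norm y)\<^sup>2" by (intro power_mono norm_triangle_ineq) simp
  also have "\<dots> \<le> 2 * (norm x)\<^sup>2 + 2 * (norm y)\<^sup>2"
    using sum_squares_bound[of "norm x" "norm y"] by (simp add: power2_sum)
  finally show ?thesis .
qed

lemma in_L2_add:
  assumes "in_L2 M f" "in_L2 M g"
  shows "in_L2 M (\<lambda>x. f x + g x)"
  unfolding in_L2_def
proof
  have [measurable]: "f \<in> borel_measurable M" "g \<in> borel_measurable M" using assms by (auto simp: in_L2_def)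
  show "(\<lambda>x. f x + g x) \<in> borel_measurable M" by measurable
  have int: "integrable M (\<lambda>x. 2 * (cmod (f x))\<^sup>2 + 2 * (cmod (g x))\<^sup>2)" using assms by (auto simp: in_L2_def)
  show "integrable M (\<lambda>x. (cmod (f x + g x))\<^sup>2)"
    by (rule Bochner_Integration.integrable_bound[OF int]) (auto intro!: AE_I2 order_trans[OF norm_add_squared_le])
qed

lemma in_L2_mult:
  assumes "in_L2 M f" "u \<in> borel_measurable M" "\<And>x. cmod (u x) \<le> B"
  shows "in_L2 M (\<lambda>x. u x * f x)"
  unfolding in_L2_def
proof
  have [measurable]: "f \<in> borel_measurable M" "u \<in> borel_measurable M" using assms by (auto simp: in_L2_def)
  show "(\<lambda>x. u x * f x) \<in> borel_measurable M" by measurable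
  have int: "integrable M (\<lambda>x. B\<^sup>2 * (cmod (f x))\<^sup>2)" using assms by (auto simp: in_L2_def)
  show "integrable M (\<lambda>x. (cmod (u x * f x))\<^sup>2)"
    by (rule Bochner_Integration.integrable_bound[OF int])
      (auto intro!: AE_I2 mult_right_mono power_mono assms simp: norm_mult power_mult_distrib)
qed

lemma in_L2_sum:
  assumes "finite I" "\<And>i. i \<in> I \<Longrightarrow> in_L2 M (f i)"
  shows "in_L2 M (\<lambda>x. \<Sum>i\<in>I. f i x)"
  using assms
  by (induction I rule: finite_induct) (auto intro!: in_L2_add simp: in_L2_def[of M "\<lambda>x. 0"])

lemma in_L2_diff:
  assumes "in_L2 M f" "in_L2 M g"
  shows "in_L2 M (\<lambda>x. f x - g x)"
  using in_L2_add[OF assms(1) in_L2_mult[OF assms(2), of "\<lambda>_. -1" 1]] by simp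

lemma (in finite_measure) in_L2_bounded:
  assumes "f \<in> borel_measurable M" "\<And>x. x \<in> space M \<Longrightarrow> cmod (f x) \<le> B"
  shows "in_L2 M f"
  unfolding in_L2_def
proof
  show "integrable M (\<lambda>x. (cmod (f x))\<^sup>2)"
    using assms by (intro integrable_const_bound[of _ "B\<^sup>2"]) (auto intro!: AE_I2 power_mono)
qed fact

text \<open>Takes the place of the triangle inequality for the norm; the factor 2 is harmless for
  approximation.\<close>

lemma integral_norm_add_squared_le:
  assumes "in_L2 M f" "in_L2 M g"
  shows "(LINT x|M. (cmod (f x + g x))\<^sup>2) \<le> 2 * (LINT x|M. (cmod (f x))\<^sup>2) + 2 * (LINT x|M. (cmod (g x))\<^sup>2)"
proof -
  have int: "integrable M (\<lambda>x. (cmod (f x))\<^sup>2)" "integrable M (\<lambda>x. (cmod (g x))\<^sup>2)"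
    "integrable M (\<lambda>x. (cmod (f x + g x))\<^sup>2)"
    using assms in_L2_add[OF assms] by (auto simp: in_L2_def)
  have "(LINT x|M. (cmod (f x + g x))\<^sup>2) \<le> (LINT x|M. 2 * (cmod (f x))\<^sup>2 + 2 * (cmod (g x))\<^sup>2)"
    using int by (intro integral_mono norm_add_squared_le) auto
  then show ?thesis using int by simp
qed

lemma in_L2_continuous:
  assumes "compact S" "continuous_on S f"
  shows "in_L2 (lebesgue_on S) f"
proof -
  interpret finite_measure "lebesgue_on S"
    using assms(1) by (intro finite_measure_lebesgue_on lmeasurable_compact)
  obtain B where "\<And>x. x \<in> S \<Longrightarrow> cmod (f x) \<le> B"
    using compact_imp_bounded[OF compact_continuous_image[OF assms(2,1)]] by (auto simp: bounded_iff)
  then show ?thesis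
    using assms by (intro in_L2_bounded[of _ B] continuous_imp_measurable_on_sets_lebesgue)
      (auto simp: lmeasurable_compact fmeasurableD)
qed

section \<open>Density on the unit interval\<close>

abbreviation unit_measure :: "real measure" where
  "unit_measure \<equiv> lebesgue_on {0..1}"

text \<open>The error is measured by the squared norm, since that is additive over the cells of
  \<open>A + [0, 1]\<close>.\<close>

definition exp_approximable :: "(real \<Rightarrow> complex) \<Rightarrow> bool" where
  "exp_approximable f \<longleftrightarrow>
     (\<forall>\<epsilon>>0. \<exists>p. exp_span \<int> p \<and> (LINT x|unit_measure. (cmod (f x - p x))\<^sup>2) < \<epsilon>)"

text \<open>Two errors below \<open>\<epsilon> / 4\<close> are each doubled when the squared norms
  are added.\<close>

lemma exp_approximable_limit:
  assumes f: "in_L2 unit_measure f"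
    and h: "\<And>n::nat. in_L2 unit_measure (h n)" "\<And>n. exp_approximable (h n)"
    and lim: "(\<lambda>n. LINT x|unit_measure. (cmod (f x - h n x))\<^sup>2) \<longlonglongrightarrow> 0"
  shows "exp_approximable f"
  unfolding exp_approximable_def
proof (intro allI impI)
  fix \<epsilon> :: real assume \<epsilon>: "\<epsilon> > 0"
  then have "eventually (\<lambda>n. (LINT x|unit_measure. (cmod (f x - h n x))\<^sup>2) < \<epsilon> / 4) sequentially"
    using order_tendstoD(2)[OF lim, of "\<epsilon> / 4"] by simp
  then obtain n where n: "(LINT x|unit_measure. (cmod (f x - h n x))\<^sup>2) < \<epsilon> / 4"
    using eventually_happens' sequentially_bot by blast
  obtain p where p: "exp_span \<int> p" "(LINT x|unit_measure. (cmod (h n x - p x))\<^sup>2) < \<epsilon> / 4"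
    using h(2)[of n] \<epsilon> unfolding exp_approximable_def by (meson divide_pos_pos zero_less_numeral)
  have "in_L2 unit_measure p" using p(1) by (intro in_L2_continuous continuous_on_exp_span) auto
  then have "(LINT x|unit_measure. (cmod ((f x - h n x) + (h n x - p x)))\<^sup>2) < \<epsilon>"
    using integral_norm_add_squared_le[of unit_measure "\<lambda>x. f x - h n x" "\<lambda>x. h n x - p x"] n p(2) f h(1)
    by (force intro!: in_L2_diff)
  then show "\<exists>p. exp_span \<int> p \<and> (LINT x|unit_measure. (cmod (f x - p x))\<^sup>2) < \<epsilon>"
    using p(1) by auto
qed

lemma measure_unit_measure: "measure unit_measure (space unit_measure) = 1"
  by (simp add: measure_restrict_space)

lemma exp_approximable_periodic_continuous:
  assumes cont: "continuous_on {0..1} h" and per: "h 0 = h 1"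
  shows "exp_approximable h"
  unfolding exp_approximable_def
proof (intro allI impI)
  fix \<epsilon> :: real assume \<epsilon>: "\<epsilon> > 0"
  interpret finite_measure unit_measure by (intro finite_measure_lebesgue_on) auto
  \<comment> \<open>A uniform error below \<open>sqrt (\<epsilon> / 2)\<close> on an interval of
    length 1 has squared norm at most \<open>\<epsilon> / 2\<close>.\<close>
  obtain p where p: "exp_span \<int> p" "\<And>x. x \<in> {0..1} \<Longrightarrow> cmod (h x - p x) < sqrt (\<epsilon> / 2)"
    using periodic_continuous_uniform_approx[OF assms, of "sqrt (\<epsilon> / 2)"] \<epsilon> by auto
  have "in_L2 unit_measure (\<lambda>x. h x - p x)"
    using cont continuous_on_exp_span[OF p(1)] by (intro in_L2_continuous continuous_on_diff) auto
  then have "(LINT x|unit_measure. (cmod (h x - p x))\<^sup>2) \<le> (LINT x|unit_measure. (sqrt (\<epsilon> / 2))\<^sup>2)"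
    using p(2) by (intro integral_mono power_mono) (auto simp: in_L2_def less_imp_le)
  also have "\<dots> < \<epsilon>" using \<epsilon> measure_unit_measure by simp
  finally show "\<exists>p. exp_span \<int> p \<and> (LINT x|unit_measure. (cmod (h x - p x))\<^sup>2) < \<epsilon>"
    using p(1) by blast
qed

text \<open>The factor \<open>\<phi>\<close> makes the continuous approximants vanish at both end points, so that they
  become periodic.\<close>

lemma exp_approximable_bounded:
  assumes meas: "f \<in> borel_measurable unit_measure" and B: "\<And>x. x \<in> {0..1} \<Longrightarrow> cmod (f x) \<le> B"
  shows "exp_approximable f"
proof -
  interpret finite_measure unit_measure by (intro finite_measure_lebesgue_on) auto
  have B0: "B \<ge> 0" using order_trans[OF norm_ge_zero B[of 0]] by simp
  have "(\<lambda>x. indicator {0..1} x *\<^sub>R f x) \<in> borel_measurable lebesgue"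
    using meas borel_measurable_restrict_space_iff[of "{0..1}" lebesgue f] by simp
  then have "(\<lambda>x. indicator {0..1} x *\<^sub>R f x) measurable_on UNIV"
    by (intro lebesgue_measurable_imp_measurable_on) auto
  \<comment> \<open>Extended by zero, \<open>f\<close> is almost everywhere a limit of continuous
    functions.\<close>
  then have "\<exists>N g. negligible N \<and> (\<forall>n::nat. continuous_on UNIV (g n)) \<and>
      (\<forall>x. x \<notin> N \<longrightarrow> (\<lambda>n. g n x) \<longlonglongrightarrow> (if x \<in> UNIV then indicator {0..1} x *\<^sub>R f x else 0))"
    by (simp only: measurable_on_def)
  then obtain N g where Ng: "negligible N \<and> (\<forall>n::nat. continuous_on UNIV (g n)) \<and>
      (\<forall>x. x \<notin> N \<longrightarrow> (\<lambda>n. g n x) \<longlonglongrightarrow> (if x \<in> UNIV then indicator {0..1} x *\<^sub>R f x else 0))"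
    by (elim exE) (rule that)
  note N = Ng[THEN conjunct1] and g = Ng[THEN conjunct2, THEN conjunct1]
    and lim = Ng[THEN conjunct2, THEN conjunct2]
  define \<phi> :: "nat \<Rightarrow> real \<Rightarrow> real" where "\<phi> n x = min 1 (real n * (x * (1 - x)))" for n x
  \<comment> \<open>The projection to the ball of radius \<open>B\<close> is continuous and fixes
    the values of \<open>f\<close> on \<open>[0, 1]\<close>: it keeps the approximants bounded
    without changing the limit.\<close>
  let ?cp = "closest_point (cball (0::complex) B)"
  define h where "h n x = \<phi> n x *\<^sub>R ?cp (g n x)" for n x
  have cp: "continuous_on UNIV ?cp"
    using B0 by (intro continuous_on_closest_point) auto
  have cpB: "cmod (?cp z) \<le> B" for z
    using closest_point_in_set[of "cball (0::complex) B" z] B0 by auto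
  have \<phi>: "0 \<le> \<phi> n x" "\<phi> n x \<le> 1" if "x \<in> {0..1}" for n x using that by (auto simp: \<phi>_def)
  have hB: "cmod (h n x) \<le> B" if "x \<in> {0..1}" for n x
    using \<phi>[OF that, of n] cpB[of "g n x"] mult_mono[of "\<phi> n x" 1 "cmod (?cp (g n x))" B] by (simp add: h_def)
  have hc: "continuous_on {0..1} (h n)" for n
    unfolding h_def \<phi>_def
    by (intro continuous_intros continuous_on_compose2[OF cp] continuous_on_subset[OF g[rule_format]]) auto
  show ?thesis
  proof (rule exp_approximable_limit)
    show "in_L2 unit_measure f" using meas B by (intro in_L2_bounded) auto
    show L2h: "in_L2 unit_measure (h n)" for n using hc by (intro in_L2_continuous) auto
    show "exp_approximable (h n)" for n
      using hc by (intro exp_approximable_periodic_continuous) (auto simp: h_def \<phi>_def)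
    have "(\<lambda>n. LINT x|unit_measure. (cmod (f x - h n x))\<^sup>2) \<longlonglongrightarrow> (LINT x|unit_measure. 0)"
    proof (rule integral_dominated_convergence[where w = "\<lambda>_. (2 * B)\<^sup>2"])
      show "(\<lambda>x. (cmod (f x - h n x))\<^sup>2) \<in> borel_measurable unit_measure" for n
        using meas L2h[of n] by (auto simp: in_L2_def)
      have "(cmod (f x - h n x))\<^sup>2 \<le> (2 * B)\<^sup>2" if "x \<in> {0..1}" for n x
        using norm_triangle_ineq4[of "f x" "h n x"] B[OF that] hB[OF that, of n] by (intro power_mono) auto
      then show "AE x in unit_measure. norm ((cmod (f x - h n x))\<^sup>2) \<le> (2 * B)\<^sup>2" for n
        by (intro AE_I2) auto
      \<comment> \<open>At the end points \<open>\<phi> n x\<close> stays 0, so they join the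
        exceptional null set.\<close>
      have conv: "(\<lambda>n. (cmod (f x - h n x))\<^sup>2) \<longlonglongrightarrow> 0" if x: "x \<in> {0..1}" "x \<notin> N \<union> {0, 1}" for x
      proof -
        have x01: "0 < x * (1 - x)" using x by auto
        obtain n0 :: nat where n0: "1 < real n0 * (x * (1 - x))" using reals_Archimedean3[OF x01] by blast
        have "\<phi> n x = 1" if "n \<ge> n0" for n
          using n0 mult_right_mono[of "real n0" "real n" "x * (1 - x)"] x01 that by (simp add: \<phi>_def)
        then have 1: "(\<lambda>n. \<phi> n x) \<longlonglongrightarrow> 1"
          by (intro tendsto_eventually eventually_sequentiallyI[of n0]) auto
        have "(\<lambda>n. g n x) \<longlonglongrightarrow> f x" using lim[rule_format, of x] x by simp
        then have "(\<lambda>n. ?cp (g n x)) \<longlonglongrightarrow> ?cp (f x)"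
          using cp continuous_on_tendsto_compose[of UNIV ?cp] by auto
        also have "?cp (f x) = f x" using B[OF x(1)] by (intro closest_point_self) simp
        finally have "(\<lambda>n. h n x) \<longlonglongrightarrow> f x" unfolding h_def using tendsto_scaleR[OF 1] by fastforce
        then have "(\<lambda>n. (cmod (f x - h n x))\<^sup>2) \<longlonglongrightarrow> (cmod (f x - f x))\<^sup>2" by (intro tendsto_intros)
        then show ?thesis by simp
      qed
      have "N \<union> {0, 1} \<in> null_sets lebesgue"
        using N by (intro null_sets.Un) (auto simp: negligible_iff_null_sets intro: null_sets_lebesgue_countable)
      then have "AE x in lebesgue. x \<notin> N \<union> {0, 1}" by (rule AE_not_in)
      then show "AE x in unit_measure. (\<lambda>n. (cmod (f x - h n x))\<^sup>2) \<longlonglongrightarrow> 0"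
        using conv by (subst AE_restrict_space_iff) (auto elim!: eventually_mono simp del: Un_iff Un_insert_right)
    qed auto
    then show "(\<lambda>n. LINT x|unit_measure. (cmod (f x - h n x))\<^sup>2) \<longlonglongrightarrow> 0" by simp
  qed
qed

text \<open>Truncation at height \<open>n\<close> gives bounded functions, and the square of
  \<open>cmod (f x)\<close> dominates the squared errors.\<close>

lemma exp_approximable_L2:
  assumes f: "in_L2 unit_measure f"
  shows "exp_approximable f"
proof -
  define h where "h n x = (if cmod (f x) \<le> real n then f x else 0)" for n x
  have [measurable]: "f \<in> borel_measurable unit_measure" using f by (simp add: in_L2_def)
  have hm [measurable]: "h n \<in> borel_measurable unit_measure" for n unfolding h_def by measurable
  interpret finite_measure unit_measure by (intro finite_measure_lebesgue_on) auto
  have hB: "cmod (h n x) \<le> real n" for n x by (simp add: h_def)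
  show ?thesis
  proof (rule exp_approximable_limit[OF f])
    show "in_L2 unit_measure (h n)" for n using hm hB by (intro in_L2_bounded) auto
    show "exp_approximable (h n)" for n using hm hB by (intro exp_approximable_bounded) auto
    have "(\<lambda>n. LINT x|unit_measure. (cmod (f x - h n x))\<^sup>2) \<longlonglongrightarrow> (LINT x|unit_measure. 0)"
    proof (rule integral_dominated_convergence[where w = "\<lambda>x. (cmod (f x))\<^sup>2"])
      show "integrable unit_measure (\<lambda>x. (cmod (f x))\<^sup>2)" using f by (simp add: in_L2_def)
      show "AE x in unit_measure. norm ((cmod (f x - h n x))\<^sup>2) \<le> (cmod (f x))\<^sup>2" for n
        by (intro AE_I2) (simp add: h_def)
      have "(\<lambda>n. (cmod (f x - h n x))\<^sup>2) \<longlonglongrightarrow> 0" for x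
      proof -
        obtain n0 where "cmod (f x) \<le> real n0" using real_arch_simple by blast
        then show ?thesis by (intro tendsto_eventually eventually_sequentiallyI[of n0]) (auto simp: h_def)
      qed
      then show "AE x in unit_measure. (\<lambda>n. (cmod (f x - h n x))\<^sup>2) \<longlonglongrightarrow> 0" by simp
    qed auto
    then show "(\<lambda>n. LINT x|unit_measure. (cmod (f x - h n x))\<^sup>2) \<longlonglongrightarrow> 0" by simp
  qed
qed

section \<open>Splitting \<open>A + [0, 1]\<close> into unit cells\<close>

lemma indicator_plus_unit_interval:
  assumes "finite A" "x \<notin> \<int>"
  shows "(indicator (plus_unit_interval A) x :: real) = (\<Sum>a\<in>A. indicator {0..1} (x - real_of_int a))"
proof -
  have "indicator {0..1} (x - real_of_int a) = (if \<lfloor>x\<rfloor> = a then 1 else 0 :: real)" for a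
  proof (cases "\<lfloor>x\<rfloor> = a")
    case True
    then show ?thesis by (auto simp: indicator_def) linarith+
  next
    case False
    have "x \<noteq> real_of_int a + 1" using assms(2) by auto
    then have "\<not> (0 \<le> x - real_of_int a \<and> x - real_of_int a \<le> 1)" using False by linarith
    then show ?thesis using False by (simp add: indicator_def)
  qed
  then show ?thesis using assms by (simp add: mem_plus_unit_interval_floor indicator_def)
qed

lemma plus_unit_interval_lmeasurable: "finite A \<Longrightarrow> plus_unit_interval A \<in> lmeasurable"
  by (intro lmeasurable_compact compact_plus_unit_interval)

lemma plus_unit_interval_shift: "a \<in> A \<Longrightarrow> x \<in> {0..1} \<Longrightarrow> x + real_of_int a \<in> plus_unit_interval A"
  by (auto simp: mem_plus_unit_interval intro!: bexI[of _ a])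

text \<open>\<open>f\<close> is extended by zero, so that the affine substitution on the whole line
  applies; for \<open>a \<in> A\<close> the shifted interval stays where the extension equals
  \<open>f\<close>.\<close>

lemma measurable_shift:
  fixes f :: "real \<Rightarrow> complex"
  assumes A: "finite A" "a \<in> A" and f: "f \<in> borel_measurable (lebesgue_on (plus_unit_interval A))"
  shows "(\<lambda>x. f (x + real_of_int a)) \<in> borel_measurable unit_measure"
proof -
  let ?f = "\<lambda>x. indicator (plus_unit_interval A) x *\<^sub>R f x"
  have "?f \<in> borel_measurable lebesgue"
    using f plus_unit_interval_lmeasurable[OF A(1)]
      borel_measurable_restrict_space_iff[of "plus_unit_interval A" lebesgue f] by (simp add: fmeasurableD)
  then have "(\<lambda>x. ?f (real_of_int a + 1 *\<^sub>R x)) \<in> borel_measurable lebesgue"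
    by (intro borel_measurable_affine) auto
  then have m: "(\<lambda>x. ?f (real_of_int a + 1 *\<^sub>R x)) \<in> borel_measurable unit_measure"
    by (rule measurable_restrict_space1)
  have eq: "?f (real_of_int a + 1 *\<^sub>R x) = f (x + real_of_int a)" if "x \<in> space unit_measure" for x
    using plus_unit_interval_shift[OF A(2), of x] that by (simp add: add.commute)
  from measurable_cong[of unit_measure, OF eq] m show ?thesis by (rule iffD1)
qed

text \<open>Up to the null set of integers the cells are disjoint, and each is translated back to
  \<open>[0, 1]\<close>.\<close>

lemma integral_plus_unit_interval:
  fixes h :: "real \<Rightarrow> 'b::euclidean_space"
  assumes A: "finite A" and h: "integrable (lebesgue_on (plus_unit_interval A)) h"
  shows "a \<in> A \<Longrightarrow> integrable unit_measure (\<lambda>x. h (x + real_of_int a))"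
    and "(LINT x|lebesgue_on (plus_unit_interval A). h x) = (\<Sum>a\<in>A. LINT x|unit_measure. h (x + real_of_int a))"
proof -
  let ?P = "plus_unit_interval A"
  let ?h = "\<lambda>x. indicator ?P x *\<^sub>R h x"
  have P: "?P \<in> sets lebesgue" using plus_unit_interval_lmeasurable[OF A] by (simp add: fmeasurableD)
  have int: "integrable lebesgue ?h" using h P integrable_restrict_space[of ?P lebesgue h] by simp
  let ?g = "\<lambda>a x. indicator {0..1} (x - real_of_int a) *\<^sub>R h x"
  have shift: "?g a (real_of_int a + 1 * x) = indicator {0..1} x *\<^sub>R h (x + real_of_int a)" for a x
    by (simp add: add.commute)
  \<comment> \<open>A cell with \<open>a \<in> A\<close> lies inside \<open>?P\<close>, hence its
    integrand inherits the integrability of \<open>?h\<close>.\<close>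
  have g_eq: "?g a = (\<lambda>x. indicator {real_of_int a..real_of_int a + 1} x *\<^sub>R ?h x)" if "a \<in> A" for a
  proof
    fix x
    show "?g a x = indicator {real_of_int a..real_of_int a + 1} x *\<^sub>R ?h x"
    proof (cases "x \<in> {real_of_int a..real_of_int a + 1}")
      case True
      then have "x \<in> ?P" using plus_unit_interval_shift[OF that, of "x - real_of_int a"] by simp
      then show ?thesis using True by simp
    next
      case False
      then show ?thesis by (auto simp: indicator_def)
    qed
  qed
  have gint: "integrable lebesgue (?g a)" if "a \<in> A" for a
    unfolding g_eq[OF that] by (rule integrable_mult_indicator[OF _ int]) simp
  have unit: "integrable lebesgue (\<lambda>x. indicator {0..1} x *\<^sub>R h (x + real_of_int a))" if "a \<in> A" for a
    using lebesgue_integrable_real_affine[OF gint[OF that], of 1 "real_of_int a"] unfolding shift by simp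
  then show "a \<in> A \<Longrightarrow> integrable unit_measure (\<lambda>x. h (x + real_of_int a))"
    using integrable_restrict_space[of "{0..1}" lebesgue "\<lambda>x. h (x + real_of_int a)"] by simp
  have "(\<int> :: real set) \<in> null_sets lebesgue"
    by (intro null_sets_lebesgue_countable) (simp add: Ints_def)
  then have ae: "AE x in lebesgue. ?h x = (\<Sum>a\<in>A. ?g a x)"
    by (rule AE_not_in[THEN eventually_mono])
      (simp add: indicator_plus_unit_interval[OF A] scaleR_sum_left)
  have "(LINT x|lebesgue_on ?P. h x) = (LINT x|lebesgue. ?h x)"
    using P by (simp add: integral_restrict_space)
  also have "\<dots> = (LINT x|lebesgue. (\<Sum>a\<in>A. ?g a x))"
    using int gint by (intro integral_cong_AE ae borel_measurable_integrable borel_measurable_sum) auto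
  also have "\<dots> = (\<Sum>a\<in>A. LINT x|lebesgue. ?g a x)" using gint by (intro Bochner_Integration.integral_sum)
  also have "\<dots> = (\<Sum>a\<in>A. LINT x|unit_measure. h (x + real_of_int a))"
  proof (rule sum.cong[OF refl])
    fix a assume "a \<in> A"
    have "(LINT x|lebesgue. ?g a x) = (LINT x|lebesgue. ?g a (real_of_int a + 1 * x))"
      using lebesgue_integral_real_affine[of 1 "?g a" "real_of_int a"] by simp
    also have "\<dots> = (LINT x|unit_measure. h (x + real_of_int a))"
      unfolding shift by (simp add: integral_restrict_space)
    finally show "(LINT x|lebesgue. ?g a x) = (LINT x|unit_measure. h (x + real_of_int a))" .
  qed
  finally show "(LINT x|lebesgue_on ?P. h x) = (\<Sum>a\<in>A. LINT x|unit_measure. h (x + real_of_int a))" .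
qed

text \<open>The antiderivative takes equal values at 0 and 1.\<close>

lemma integral_exponential_unit:
  assumes "l \<in> \<int>" "l \<noteq> 0"
  shows "(LINT x|unit_measure. exponential l x) = 0"
proof -
  have "integrable unit_measure (exponential l)"
    by (intro continuous_imp_integrable_real continuous_on_exponential continuous_on_id)
  then have "(LINT x|unit_measure. exponential l x) = integral {0..1} (exponential l)"
    by (intro lebesgue_integral_eq_integral) auto
  also have "\<dots> = 0"
  proof (rule integral_unique)
    let ?c = "2 * complex_of_real pi * \<i> * complex_of_real l"
    let ?F = "\<lambda>x. exponential l x / ?c"
    have c: "?c \<noteq> 0" using assms(2) by simp
    have "((\<lambda>x. exp (?c * x) / ?c) has_field_derivative exp (?c * of_real x)) (at (of_real x))" for x :: real
      using c by (auto intro!: derivative_eq_intros)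
    then have "(?F has_vector_derivative exponential l x) (at x within {0..1})" for x
      using has_vector_derivative_real_field has_vector_derivative_at_within unfolding exponential_def by fastforce
    then have "(exponential l has_integral ?F 1 - ?F 0) {0..1}"
      by (intro fundamental_theorem_of_calculus) auto
    moreover have "exponential l 1 = 1" using assms(1) by (simp add: exponential_eq_1_iff)
    ultimately show "(exponential l has_integral 0) {0..1}" by simp
  qed
  finally show ?thesis .
qed

section \<open>Orthogonality and density of the frequencies \<open>G + \<int>\<close>\<close>

lemma exponential_in_L2:
  "finite A \<Longrightarrow> in_L2 (lebesgue_on (plus_unit_interval A)) (exponential l)"
  by (intro in_L2_continuous compact_plus_unit_interval continuous_on_exponential continuous_on_id)

text \<open>The integral of \<open>exponential d\<close> is a sum over \<open>A\<close> times an
  integral over \<open>[0, 1]\<close>. If \<open>g = g'\<close>, then \<open>d\<close> is a nonzero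
  integer and the integral vanishes; otherwise the sum does, because at integer points it depends on
  \<open>d\<close> modulo 1 only.\<close>

lemma exponential_orthogonal_plus_unit_interval:
  assumes A: "finite A" "A \<noteq> {}" and orth: "exp_orthogonal (real_of_int ` A) G"
    and g: "g \<in> G" "g' \<in> G" and neq: "g + real_of_int k \<noteq> g' + real_of_int k'"
  shows "L2_inner (lebesgue_on (plus_unit_interval A))
    (exponential (g + real_of_int k)) (exponential (g' + real_of_int k')) = 0"
proof -
  let ?P = "plus_unit_interval A"
  define d where "d = (g + real_of_int k) - (g' + real_of_int k')"
  have inn: "exponential (g + real_of_int k) x * cnj (exponential (g' + real_of_int k') x) = exponential d x" for x
    unfolding d_def by (simp add: exponential_diff)
  interpret finite_measure "lebesgue_on ?P"
    by (intro finite_measure_lebesgue_on plus_unit_interval_lmeasurable A)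
  have "exponential d \<in> borel_measurable (lebesgue_on ?P)"
    using exponential_in_L2[OF A(1)] by (simp add: in_L2_def)
  then have "integrable (lebesgue_on ?P) (exponential d)"
    by (intro integrable_const_bound[of _ 1]) auto
  then have "(LINT x|lebesgue_on ?P. exponential d x) = (\<Sum>a\<in>A. LINT x|unit_measure. exponential d (x + real_of_int a))"
    by (rule integral_plus_unit_interval(2)[OF A(1)])
  also have "\<dots> = (\<Sum>a\<in>A. exponential d (real_of_int a)) * (LINT x|unit_measure. exponential d x)"
    by (simp add: exponential_add_right sum_distrib_right mult.commute)
  also have "\<dots> = 0"
  proof (cases "g = g'")
    case True
    then have "d = real_of_int (k - k')" by (simp add: d_def)
    moreover have "k \<noteq> k'" using neq True by auto
    ultimately show ?thesis using integral_exponential_unit[of d] by simp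
  next
    case False
    have "exponential d (real_of_int a) = exponential (g - g') (real_of_int a)" for a
    proof -
      have "d = (g - g') + real_of_int (k - k')" by (simp add: d_def)
      then show ?thesis by (simp only: exponential_add exponential_of_int_of_int mult_1_right)
    qed
    then have "(\<Sum>a\<in>A. exponential d (real_of_int a)) = (\<Sum>x\<in>real_of_int ` A. exponential (g - g') x)"
      by (subst sum.reindex) (auto simp: inj_on_def)
    also have "\<dots> = 0" using exp_orthogonalD[OF orth g False] .
    finally show ?thesis by simp
  qed
  finally show ?thesis by (simp add: L2_inner_def inn)
qed

lemma exponentials_dense_plus_unit_interval:
  assumes A: "finite A" and spec: "discrete_spectrum (real_of_int ` A) G"
    and f: "in_L2 (lebesgue_on (plus_unit_interval A)) f" and \<epsilon>: "\<epsilon> > 0"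
  shows "\<exists>q. exp_span (\<Union>g\<in>G. range (\<lambda>k::int. g + real_of_int k)) q \<and>
    (LINT x|lebesgue_on (plus_unit_interval A). (cmod (f x - q x))\<^sup>2) < \<epsilon>"
proof -
  let ?P = "plus_unit_interval A" and ?N = "real (card G)"
  have G: "finite G" "G \<noteq> {}" and oG: "exp_orthogonal G (real_of_int ` A)"
    using spec by (auto simp: discrete_spectrum_def)
  have N: "?N > 0" using G by (simp add: card_gt_0_iff)
  \<comment> \<open>Orthogonality of the columns makes the adjoint divided by \<open>card G\<close>
    an inverse of the exponential matrix.\<close>
  define F where "F g x = (1 / ?N) * (\<Sum>a\<in>A. f (x + real_of_int a) * cnj (exponential g (x + real_of_int a)))" for g x
  have fa: "in_L2 unit_measure (\<lambda>x. f (x + real_of_int a))" if "a \<in> A" for a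
    using f measurable_shift[OF A that, of f] integral_plus_unit_interval(1)[OF A _ that, of "\<lambda>x. (cmod (f x))\<^sup>2"]
    by (simp add: in_L2_def)
  have e_meas: "(\<lambda>x. cnj (exponential g (x + b))) \<in> borel_measurable unit_measure" for g b
    by (intro continuous_imp_measurable_on_sets_lebesgue continuous_intros) auto
  have FL2: "in_L2 unit_measure (F g)" for g
  proof -
    have "in_L2 unit_measure (\<lambda>x. cnj (exponential g (x + real_of_int a)) * f (x + real_of_int a))" if "a \<in> A" for a
      by (rule in_L2_mult[OF fa[OF that] e_meas, of _ _ 1]) simp
    then have "in_L2 unit_measure (\<lambda>x. \<Sum>a\<in>A. cnj (exponential g (x + real_of_int a)) * f (x + real_of_int a))"
      by (intro in_L2_sum A)
    from in_L2_mult[OF this, of "\<lambda>_. complex_of_real (1 / ?N)" "1 / ?N"] show ?thesis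
      unfolding F_def[abs_def] by (simp add: mult.commute norm_divide)
  qed
  have recon: "f (x + real_of_int a) = (\<Sum>g\<in>G. F g x * exponential g (x + real_of_int a))" if a: "a \<in> A" for x a
  proof -
    have "(\<Sum>g\<in>G. F g x * exponential g (x + real_of_int a)) =
        (\<Sum>g\<in>G. \<Sum>b\<in>A. (1 / ?N) * f (x + real_of_int b) * exponential (real_of_int a - real_of_int b) g)"
    proof (rule sum.cong[OF refl])
      fix g
      have "cnj (exponential g (x + real_of_int b)) * exponential g (x + real_of_int a) = exponential (real_of_int a - real_of_int b) g" for b
        unfolding exponential_commute[of g] exponential_diff[symmetric] mult.commute[of "cnj _"] by simp
      then show "F g x * exponential g (x + real_of_int a) =
          (\<Sum>b\<in>A. (1 / ?N) * f (x + real_of_int b) * exponential (real_of_int a - real_of_int b) g)"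
        unfolding F_def sum_distrib_left sum_distrib_right by (simp add: mult.assoc)
    qed
    \<comment> \<open>After the exchange the inner sum is \<open>card G\<close> for
      \<open>b = a\<close> and 0 otherwise.\<close>
    also have "\<dots> = (\<Sum>b\<in>A. (1 / ?N) * f (x + real_of_int b) * (\<Sum>g\<in>G. exponential (real_of_int a - real_of_int b) g))"
      by (subst sum.swap) (simp add: sum_distrib_left)
    also have "\<dots> = (\<Sum>b\<in>A. if b = a then f (x + real_of_int b) else 0)"
    proof (rule sum.cong[OF refl])
      fix b assume b: "b \<in> A"
      show "(1 / ?N) * f (x + real_of_int b) * (\<Sum>g\<in>G. exponential (real_of_int a - real_of_int b) g) =
          (if b = a then f (x + real_of_int b) else 0)"
        using exp_orthogonalD[OF oG, of "real_of_int a" "real_of_int b"] a b N by auto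
    qed
    also have "\<dots> = f (x + real_of_int a)" using a A by simp
    finally show ?thesis by simp
  qed
  \<comment> \<open>Each of the \<open>card A\<close> cells will contribute at most
    \<open>?N\<^sup>2 * \<eta>\<close>, so the total stays below \<open>\<epsilon> / 2\<close>;
    adding 1 avoids a zero denominator.\<close>
  define \<eta> where "\<eta> = \<epsilon> / (2 * ?N\<^sup>2 * (real (card A) + 1))"
  have \<eta>: "\<eta> > 0" using N \<epsilon> by (simp add: \<eta>_def)
  have "\<exists>p. exp_span \<int> p \<and> (LINT x|unit_measure. (cmod (F g x - p x))\<^sup>2) < \<eta>" for g
    using exp_approximable_L2[OF FL2] \<eta> by (simp add: exp_approximable_def)
  then obtain p where p: "\<And>g. exp_span \<int> (p g)" "\<And>g. (LINT x|unit_measure. (cmod (F g x - p g x))\<^sup>2) < \<eta>"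
    by metis
  define q where "q = (\<lambda>x. \<Sum>g\<in>G. p g x * exponential g x)"
  let ?L = "\<Union>g\<in>G. range (\<lambda>k::int. g + real_of_int k)"
  have q: "exp_span ?L q"
    unfolding q_def
  proof (intro exp_span_sum G)
    fix g assume g: "g \<in> G"
    have "exp_span {g} (\<lambda>x. 1 * exponential g x)" by (intro exp_span_monomial) simp
    then have "exp_span {g} (exponential g)" by simp
    with p(1) show "exp_span ?L (\<lambda>x. p g x * exponential g x)"
    proof (rule exp_span_mult)
      fix l l' assume l: "l \<in> (\<int> :: real set)" "l' \<in> {g}"
      then obtain k where "l = real_of_int k" by (elim Ints_cases)
      then show "l + l' \<in> ?L" using l g by (intro UN_I[of g] image_eqI[of _ _ k]) auto
    qed
  qed
  have qL2: "in_L2 (lebesgue_on ?P) q"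
    using q by (intro in_L2_continuous compact_plus_unit_interval A continuous_on_exp_span)
  have pL2: "in_L2 unit_measure (\<lambda>x. F g x - p g x)" for g
    using p(1) by (intro in_L2_diff FL2 in_L2_continuous continuous_on_exp_span) auto
  have bound: "(LINT x|unit_measure. (cmod (f (x + real_of_int a) - q (x + real_of_int a)))\<^sup>2) \<le> ?N\<^sup>2 * \<eta>"
    if a: "a \<in> A" for a
  proof -
    have diff: "f (x + real_of_int a) - q (x + real_of_int a) = (\<Sum>g\<in>G. (F g x - p g x) * exponential g (x + real_of_int a))" for x
      unfolding recon[OF a] q_def exp_span_Ints_periodic[OF p(1)] left_diff_distrib by (simp add: sum_subtractf)
    have pt: "(cmod (f (x + real_of_int a) - q (x + real_of_int a)))\<^sup>2 \<le> (\<Sum>g\<in>G. (cmod (F g x - p g x))\<^sup>2) * ?N" for x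
    proof -
      have "cmod (f (x + real_of_int a) - q (x + real_of_int a)) \<le> (\<Sum>g\<in>G. cmod (F g x - p g x))"
        unfolding diff by (rule order_trans[OF norm_sum]) (simp add: norm_mult)
      then have "(cmod (f (x + real_of_int a) - q (x + real_of_int a)))\<^sup>2 \<le> (\<Sum>g\<in>G. cmod (F g x - p g x))\<^sup>2"
        by (intro power_mono) auto
      \<comment> \<open>Cauchy-Schwarz costs one factor \<open>?N\<close>; the second one comes from
        adding up \<open>?N\<close> errors \<open>\<eta>\<close>.\<close>
      also have "\<dots> \<le> (\<Sum>g\<in>G. (cmod (F g x - p g x))\<^sup>2) * ?N" by (rule sum_squared_le_sum_of_squares)
      finally show ?thesis .
    qed
    have int: "integrable unit_measure (\<lambda>x. (cmod (F g x - p g x))\<^sup>2)" for g using pL2 by (simp add: in_L2_def)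
    have "integrable (lebesgue_on ?P) (\<lambda>x. (cmod (f x - q x))\<^sup>2)" using in_L2_diff[OF f qL2] by (simp add: in_L2_def)
    then have "(LINT x|unit_measure. (cmod (f (x + real_of_int a) - q (x + real_of_int a)))\<^sup>2) \<le>
        (LINT x|unit_measure. (\<Sum>g\<in>G. (cmod (F g x - p g x))\<^sup>2) * ?N)"
      using int by (intro integral_mono pt integral_plus_unit_interval(1)[OF A _ a]) auto
    also have "\<dots> = (\<Sum>g\<in>G. LINT x|unit_measure. (cmod (F g x - p g x))\<^sup>2) * ?N"
      using int by simp
    also have "\<dots> \<le> (\<Sum>g\<in>G. \<eta>) * ?N"
      using p(2) by (intro mult_right_mono sum_mono) (auto intro: less_imp_le)
    finally show ?thesis by (simp add: power2_eq_square mult_ac)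
  qed
  have "(LINT x|lebesgue_on ?P. (cmod (f x - q x))\<^sup>2) =
      (\<Sum>a\<in>A. LINT x|unit_measure. (cmod (f (x + real_of_int a) - q (x + real_of_int a)))\<^sup>2)"
    using in_L2_diff[OF f qL2] by (intro integral_plus_unit_interval(2)[OF A]) (simp add: in_L2_def)
  also have "\<dots> \<le> (\<Sum>a\<in>A. ?N\<^sup>2 * \<eta>)" by (intro sum_mono bound)
  also have "\<dots> = \<epsilon> * (real (card A) / (2 * (real (card A) + 1)))" using N by (simp add: \<eta>_def)
  also have "\<dots> < \<epsilon> * 1" using \<epsilon> by (intro mult_strict_left_mono) (simp_all add: field_simps)
  also have "\<dots> = \<epsilon>" by simp
  finally show ?thesis using q by blast
qed

lemma spectral_plus_unit_interval:
  assumes A: "finite A" "A \<noteq> {}" and spec: "discrete_spectrum (real_of_int ` A) G"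
  shows "spectral_set (plus_unit_interval A)"
proof -
  let ?P = "plus_unit_interval A" and ?L = "\<Union>g\<in>G. range (\<lambda>k::int. g + real_of_int k)"
  have P: "?P \<in> lmeasurable" using plus_unit_interval_lmeasurable[OF A(1)] .
  obtain a where a: "a \<in> A" using A(2) by blast
  have "{real_of_int a..real_of_int a + 1} \<subseteq> ?P" using a by (auto simp: mem_plus_unit_interval)
  then have "emeasure lebesgue {real_of_int a..real_of_int a + 1} \<le> emeasure lebesgue ?P"
    using P by (intro emeasure_mono) (auto simp: fmeasurableD)
  then have pos: "0 < emeasure lebesgue ?P" by (simp add: order.strict_trans2[of 0 1])
  have "0 < measure lebesgue ?P"
    using pos P by (simp add: emeasure_eq_measure2)
  \<comment> \<open>Exponentials have modulus 1, so the norm of each is the square root of this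
    measure.\<close>
  then have mpos: "measure (lebesgue_on ?P) (space (lebesgue_on ?P)) > 0"
    using P by (simp add: measure_restrict_space fmeasurableD)
  interpret finite_measure "lebesgue_on ?P" by (intro finite_measure_lebesgue_on P)
  have "orthogonal_basis_L2 (lebesgue_on ?P) ?L exponential"
    unfolding orthogonal_basis_L2_def
  proof (intro conjI ballI allI impI)
    fix l assume "l \<in> ?L"
    show "in_L2 (lebesgue_on ?P) (exponential l)" by (rule exponential_in_L2[OF A(1)])
    show "L2_norm (lebesgue_on ?P) (exponential l) \<noteq> 0" using mpos by (simp add: L2_norm_def)
  next
    fix l l' assume "l \<in> ?L" "l' \<in> ?L" "l \<noteq> l'"
    then obtain g k g' k' where "g \<in> G" "g' \<in> G" "l = g + real_of_int k" "l' = g' + real_of_int k'" by auto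
    then show "L2_inner (lebesgue_on ?P) (exponential l) (exponential l') = 0"
      using exponential_orthogonal_plus_unit_interval[OF A, of G g g' k k'] spec \<open>l \<noteq> l'\<close>
      by (simp add: discrete_spectrum_def)
  next
    fix f \<epsilon> assume f: "in_L2 (lebesgue_on ?P) f" and "\<epsilon> > (0::real)"
    \<comment> \<open>The tolerance is squared because density was shown for the squared
      norm.\<close>
    then obtain q where q: "exp_span ?L q" "(LINT x|lebesgue_on ?P. (cmod (f x - q x))\<^sup>2) < \<epsilon>\<^sup>2"
      using exponentials_dense_plus_unit_interval[OF A(1) spec f, of "\<epsilon>\<^sup>2"] by auto
    have "L2_norm (lebesgue_on ?P) (\<lambda>x. f x - q x) < sqrt (\<epsilon>\<^sup>2)"
      unfolding L2_norm_def using q(2) by (rule real_sqrt_less_mono)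
    then have "L2_norm (lebesgue_on ?P) (\<lambda>x. f x - q x) < \<epsilon>" using \<open>\<epsilon> > 0\<close> by simp
    then show "\<exists>F c. finite F \<and> F \<subseteq> ?L \<and> L2_norm (lebesgue_on ?P) (\<lambda>x. f x - (\<Sum>i\<in>F. c i * exponential i x)) < \<epsilon>"
      using q(1) unfolding exp_span_def by auto
  qed
  moreover have "emeasure lebesgue ?P < \<infinity>"
    unfolding infinity_ennreal_def less_top[symmetric] by (rule fmeasurableD2[OF P])
  ultimately show ?thesis
    using pos fmeasurableD[OF P] unfolding spectral_set_def by blast
qed

theorem theorem3p28:
  fixes A :: "int set"
  assumes "finite A" and "0 \<in> A"
  shows "((\<exists>(n::nat) (B::int set). n \<ge> 2 \<and> finite B \<and>
              is_attractor B (affine_ifs n) (plus_unit_interval A) \<and>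
              no_overlap B (affine_ifs n) (plus_unit_interval A))
          \<longleftrightarrow>
          (\<exists>(C::int set) (n::nat). finite C \<and> n > 0 \<and> direct_sum A C {0..int n - 1}))
       \<and> (\<forall>(C::int set) (n::nat). finite C \<and> n > 0 \<and> direct_sum A C {0..int n - 1} \<longrightarrow>
            tiles_by (plus_unit_interval A)
              (real_of_int ` C + range (\<lambda>k::int. real n * real_of_int k)))
       \<and> ((\<exists>(C::int set) (n::nat). finite C \<and> n > 0 \<and> direct_sum A C {0..int n - 1}) \<longrightarrow>
            spectral_set (plus_unit_interval A))"
proof (intro conjI iffI allI impI)
  assume "\<exists>(n::nat) (B::int set). n \<ge> 2 \<and> finite B \<and>
    is_attractor B (affine_ifs n) (plus_unit_interval A) \<and> no_overlap B (affine_ifs n) (plus_unit_interval A)"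
  then show "\<exists>(C::int set) (n::nat). finite C \<and> n > 0 \<and> direct_sum A C {0..int n - 1}"
    using tileable_if_attractor[OF assms] by blast
next
  assume "\<exists>(C::int set) (n::nat). finite C \<and> n > 0 \<and> direct_sum A C {0..int n - 1}"
  then show "\<exists>(n::nat) (B::int set). n \<ge> 2 \<and> finite B \<and>
    is_attractor B (affine_ifs n) (plus_unit_interval A) \<and> no_overlap B (affine_ifs n) (plus_unit_interval A)"
    using attractor_if_tileable[OF assms] by blast
next
  fix C :: "int set" and n :: nat
  assume "finite C \<and> n > 0 \<and> direct_sum A C {0..int n - 1}"
  then show "tiles_by (plus_unit_interval A) (real_of_int ` C + range (\<lambda>k::int. real n * real_of_int k))"
    using tiles_by_if_tileable[OF assms(1)] by blast
next
  assume "\<exists>(C::int set) (n::nat). finite C \<and> n > 0 \<and> direct_sum A C {0..int n - 1}"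
  then obtain G where "discrete_spectrum (real_of_int ` A) G" using exists_discrete_spectrum by blast
  then show "spectral_set (plus_unit_interval A)"
    using spectral_plus_unit_interval[OF assms(1)] assms(2) by blast
qed

end
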